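(* Let $G$ be a primitive $\mathrm{SRG}(v,k,\lambda,\mu)$ with $v\ge 6401$. Then the VC-dimension of $G$ is $2$ if and only if $\overline\mu=1$.
   Context: All graphs are finite and simple. A graph $G$ on $v$ vertices is strongly regular, an $\mathrm{SRG}(v,k,\lambda,\mu)$, if every vertex has degree $k$, any two adjacent vertices have exactly $\lambda$ common neighbors, and any two distinct nonadjacent vertices have exactly $\mu$ common neighbors. $G$ is primitive if both $G$ and its complement $\overline G$ are connected. The complement of an $\mathrm{SRG}(v,k,\lambda,\mu)$ is an $\mathrm{SRG}(v,\overline k,\overline\lambda,\overline\mu)$ with $\overline k=v-k-1$, $\overline\lambda=v-2k+\mu-2$, $\overline\mu=v-2k+\lambda$. The VC-dimension of $G$ is the maximum size of a set $S\subseteq V(G)$ that is shattered, meaning that for every $A\subseteq S$ there is a vertex $u\in V(G)$ (possibly $u\in S$) with $N(u)\cap S=A$, where $N(u)$ is the open neighborhood of $u$. *)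

theory Defs
  imports "Graph_Theory.Graph_Theory"
begin

text \<open>
  Finite simple graphs are represented by the locale predicate \<^const>\<open>pair_graph\<close>:
  finitely many vertices, with a symmetric and loop-free set of pairs as arcs, so that an
  undirected edge is the pair of opposite arcs between its ends.
\<close>

definition nbrs :: "'a pair_pre_digraph \<Rightarrow> 'a \<Rightarrow> 'a set" where
  "nbrs G u = {w. (u, w) \<in> parcs G}"

definition compl_graph :: "'a pair_pre_digraph \<Rightarrow> 'a pair_pre_digraph" where
  "compl_graph G =
     \<lparr> pverts = pverts G,
       parcs = {(x, y). x \<in> pverts G \<and> y \<in> pverts G \<and> x \<noteq> y \<and> (x, y) \<notin> parcs G} \<rparr>"

definition strongly_regular :: "'a pair_pre_digraph \<Rightarrow> nat \<Rightarrow> nat \<Rightarrow> nat \<Rightarrow> nat \<Rightarrow> bool" where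
  "strongly_regular G v k l m \<longleftrightarrow>
     pair_graph G \<and> card (pverts G) = v \<and>
     (\<forall>x \<in> pverts G. card (nbrs G x) = k) \<and>
     (\<forall>x \<in> pverts G. \<forall>y \<in> pverts G. (x, y) \<in> parcs G \<longrightarrow> card (nbrs G x \<inter> nbrs G y) = l) \<and>
     (\<forall>x \<in> pverts G. \<forall>y \<in> pverts G. x \<noteq> y \<and> (x, y) \<notin> parcs G \<longrightarrow>
        card (nbrs G x \<inter> nbrs G y) = m)"

definition primitive_graph :: "'a pair_pre_digraph \<Rightarrow> bool" where
  "primitive_graph G \<longleftrightarrow> connected (with_proj G) \<and> connected (with_proj (compl_graph G))"

text \<open>
  The parameter \<open>\<mu>\<close> of the complement, in terms of \<open>v\<close>, \<open>k\<close> and \<open>\<lambda>\<close> of the graph itself;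
  an integer, to avoid truncated subtraction.
\<close>

definition compl_mu :: "nat \<Rightarrow> nat \<Rightarrow> nat \<Rightarrow> int" where
  "compl_mu v k l = int v - 2 * int k + int l"

definition shattered :: "'a pair_pre_digraph \<Rightarrow> 'a set \<Rightarrow> bool" where
  "shattered G S \<longleftrightarrow>
     S \<subseteq> pverts G \<and> (\<forall>A \<subseteq> S. \<exists>u \<in> pverts G. nbrs G u \<inter> S = A)"

text \<open>
  For a nonempty finite graph the maximum is over a finite set containing \<open>0\<close>, since the
  empty set is shattered.
\<close>

definition vc_dim :: "'a pair_pre_digraph \<Rightarrow> nat" where
  "vc_dim G = Max (card ` {S. shattered G S})"

lemma card_common_nbrs_compl_graph:
  assumes sr: "strongly_regular G v k l m"
    and xy: "x \<in> pverts G" "y \<in> pverts G" "x \<noteq> y" "(x, y) \<notin> parcs (compl_graph G)"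
  shows "int (card (nbrs (compl_graph G) x \<inter> nbrs (compl_graph G) y)) = compl_mu v k l"
proof -
  from sr interpret pair_graph G by (simp add: strongly_regular_def)
  let ?X = "nbrs G x" and ?Y = "nbrs G y"
  have adj: "(x, y) \<in> parcs G" "(y, x) \<in> parcs G"
    using xy arcs_symmetric by (auto simp: compl_graph_def)
  have sub: "?X \<union> ?Y \<subseteq> pverts G"
    using in_arcsD2 by (auto simp: nbrs_def)
  have fin: "finite ?X" "finite ?Y" "finite (pverts G)"
    using sub pair_finite_verts finite_subset by (blast, blast, blast)
  have eq: "nbrs (compl_graph G) x \<inter> nbrs (compl_graph G) y = pverts G - (?X \<union> ?Y)"
    using xy adj by (auto simp: nbrs_def compl_graph_def)
  have "card (pverts G) = card (pverts G - (?X \<union> ?Y)) + card (?X \<union> ?Y)"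
    using sub fin by (metis add.commute card_Diff_subset card_mono finite_Un le_add_diff_inverse)
  moreover have "card ?X + card ?Y = card (?X \<union> ?Y) + card (?X \<inter> ?Y)"
    using fin by (intro card_Un_Int)
  moreover have "card (pverts G) = v" "card ?X = k" "card ?Y = k" "card (?X \<inter> ?Y) = l"
    using sr xy adj by (auto simp: strongly_regular_def)
  ultimately show ?thesis
    unfolding eq compl_mu_def by linarith
qed

end

theory Submission
  imports Defs "Jordan_Normal_Form.Schur_Decomposition"
begin

text \<open>
  Some independent pair is always shattered.  Suppose that two adjacent vertices have exactly one
  common non-neighbour.  A shattered triple cannot contain an edge \<open>ab\<close>, since the patterns
  \<open>{}\<close> and \<open>{c}\<close> come from two common non-neighbours of \<open>a\<close> and \<open>b\<close>; and if
  \<open>{x, y, z}\<close> is independent, then \<open>y\<close> and \<open>z\<close> are two common non-neighbours of \<open>x\<close> and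
  any vertex with pattern \<open>{x}\<close>.

  Conversely, suppose that no triple is shattered.  Fix a vertex \<open>z\<close>.  For two non-neighbours
  \<open>x, y\<close> of \<open>z\<close> the triple \<open>x, y, z\<close> fails to be shattered only if
  \<open>t = \<bar>N x \<inter> N y \<inter> N z\<bar>\<close> takes one of the extreme values \<open>0\<close>, \<open>\<mu>\<close>,
  \<open>\<bar>N x \<inter> N y\<bar>\<close>, \<open>2 \<mu> - k\<close>.  Hence the blocks \<open>N y \<inter> N z\<close> (or, if
  \<open>k < 2 \<mu>\<close>, the sets \<open>N z - N y\<close>) essentially partition \<open>N z\<close>, and counting common neighbours
  contradicts this as soon as \<open>\<mu> \<ge> 2\<close> and adjacent vertices have at least three common
  non-neighbours.  If they have exactly two, a shattered triple is found directly, working in the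
  complement.  If \<open>\<mu> = 1\<close> and \<open>\<lambda> \<ge> 2\<close>, a triangle inside a
  \<open>4\<close>-clique is shattered; if \<open>\<mu> = 1\<close> and \<open>\<lambda> \<le> 1\<close>, the graph is a Moore graph or a
  friendship graph, and integrality of the eigenvalue multiplicities gives \<open>k \<le> 57\<close>, whereas
  \<open>v \<ge> 80\<^sup>2 + 1\<close> forces \<open>k \<ge> 80\<close>.
\<close>

section \<open>Traces and eigenvalues\<close>

lemma trace_mult_comm:
  fixes X Y :: "'a :: comm_ring_1 mat"
  assumes "X \<in> carrier_mat n n" "Y \<in> carrier_mat n n"
  shows "(\<Sum>i<n. (X * Y) $$ (i, i)) = (\<Sum>i<n. (Y * X) $$ (i, i))"
proof -
  have "(\<Sum>i<n. (X * Y) $$ (i, i)) = (\<Sum>i<n. \<Sum>j<n. X $$ (i, j) * Y $$ (j, i))"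
    using assms by (intro sum.cong refl) (auto simp: scalar_prod_def lessThan_atLeast0 intro!: sum.cong)
  also have "\<dots> = (\<Sum>j<n. \<Sum>i<n. Y $$ (j, i) * X $$ (i, j))"
    by (subst sum.swap) (simp add: mult.commute)
  also have "\<dots> = (\<Sum>i<n. (Y * X) $$ (i, i))"
    using assms by (intro sum.cong refl) (auto simp: scalar_prod_def lessThan_atLeast0 intro!: sum.cong)
  finally show ?thesis .
qed

lemma trace_conjugate:
  fixes X P Q :: "'a :: comm_ring_1 mat"
  assumes X: "X \<in> carrier_mat n n" and P: "P \<in> carrier_mat n n" and Q: "Q \<in> carrier_mat n n"
    and QP: "Q * P = 1\<^sub>m n"
  shows "(\<Sum>i<n. (P * X * Q) $$ (i, i)) = (\<Sum>i<n. X $$ (i, i))"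
proof -
  have "(\<Sum>i<n. (P * X * Q) $$ (i, i)) = (\<Sum>i<n. (Q * (P * X)) $$ (i, i))"
    using X P Q by (intro trace_mult_comm) auto
  also have "Q * (P * X) = Q * P * X"
    using X P Q by (simp add: assoc_mult_mat[of Q n n P n X n])
  also have "\<dots> = X" using QP X by simp
  finally show ?thesis .
qed

text \<open>For \<open>j \<noteq> i\<close> one of \<open>B $$ (i, j)\<close> and
  \<open>B $$ (j, i)\<close> lies below the diagonal, so only the term \<open>j = i\<close> survives
  in the product.\<close>

lemma upper_triangular_square_diag:
  fixes B :: "'a :: comm_ring_1 mat"
  assumes B: "B \<in> carrier_mat n n" and ut: "upper_triangular B" and i: "i < n"
  shows "(B * B) $$ (i, i) = (B $$ (i, i))\<^sup>2"
proof -
  have "(B * B) $$ (i, i) = (\<Sum>j<n. B $$ (i, j) * B $$ (j, i))"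
    using B i by (auto simp: scalar_prod_def lessThan_atLeast0 intro!: sum.cong)
  also have "\<dots> = (\<Sum>j<n. if j = i then (B $$ (i, i))\<^sup>2 else 0)"
  proof (intro sum.cong refl)
    fix j assume "j \<in> {..<n}"
    then show "B $$ (i, j) * B $$ (j, i) = (if j = i then (B $$ (i, i))\<^sup>2 else 0)"
      using upper_triangularD[OF ut, of j i] upper_triangularD[OF ut, of i j] B i
      by (cases i j rule: linorder_cases) (auto simp: power2_eq_square)
  qed
  also have "\<dots> = (B $$ (i, i))\<^sup>2" using i by simp
  finally show ?thesis .
qed

text \<open>Schur triangularisation: \<open>e\<close> lists the diagonal of an upper triangular
  matrix similar to \<open>A\<close>, and similarity preserves the traces of \<open>A\<close> and
  \<open>A * A\<close>. Eigenvalues thus appear with multiplicity, and these two traces are all that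
  the later counting needs.\<close>

lemma complex_mat_traces:
  fixes A :: "complex mat"
  assumes A: "A \<in> carrier_mat n n"
  obtains e where "\<And>i. i < n \<Longrightarrow> eigenvalue A (e i)"
    and "(\<Sum>i<n. A $$ (i, i)) = (\<Sum>i<n. e i)"
    and "(\<Sum>i<n. (A * A) $$ (i, i)) = (\<Sum>i<n. (e i)\<^sup>2)"
proof -
  obtain as where "char_poly A = (\<Prod>a\<leftarrow>as. [:- a, 1:])"
    using char_poly_factorized[OF A] by auto
  from schur_decomposition_exists[OF A this]
  obtain B where B: "B \<in> carrier_mat n n" and ut: "upper_triangular B" and sim: "similar_mat A B"
    by auto
  then obtain P Q where wit: "similar_mat_wit A B P Q"
    unfolding similar_mat_def by auto
  note w = similar_mat_witD2[OF A wit]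
  have "eigenvalue A (B $$ (i, i))" if "i < n" for i
  proof -
    have "char_poly A = (\<Prod>a\<leftarrow>diag_mat B. [:- a, 1:])"
      using char_poly_similar[OF sim] char_poly_upper_triangular[OF B ut] by simp
    moreover have "B $$ (i, i) \<in> set (diag_mat B)" using that B by (auto simp: diag_mat_def)
    ultimately show ?thesis
      unfolding eigenvalue_root_char_poly[OF A] by (auto simp: poly_prod_list prod_list_zero_iff)
  qed
  moreover have "(\<Sum>i<n. A $$ (i, i)) = (\<Sum>i<n. B $$ (i, i))"
    using trace_conjugate[OF B w(6,7,2)] w(3) by simp
  moreover have "(\<Sum>i<n. (A * A) $$ (i, i)) = (\<Sum>i<n. (B $$ (i, i))\<^sup>2)"
  proof -
    have "A * A = P * B * (Q * P) * B * Q"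
      using w(3) B w(6,7)
      by (simp add: assoc_mult_mat[of _ n n _ n _ n])
    also have "\<dots> = P * (B * B) * Q"
      using w(2) B w(6,7) by (simp add: assoc_mult_mat[of _ n n _ n _ n])
    finally have "(\<Sum>i<n. (A * A) $$ (i, i)) = (\<Sum>i<n. (B * B) $$ (i, i))"
      using trace_conjugate[OF _ w(6,7,2), of "B * B"] B by simp
    then show ?thesis using upper_triangular_square_diag[OF B ut] by simp
  qed
  ultimately show thesis by (rule that)
qed

section \<open>Strongly regular graphs and their spectrum\<close>

text \<open>A bare adjacency predicate allows the graph and its complement to be two instances over
  the same \<open>V\<close>.\<close>

locale srg =
  fixes V :: "'a set" and E :: "'a \<Rightarrow> 'a \<Rightarrow> bool" and k l m :: nat
  assumes finite_V: "finite V"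
    and E_in_V: "E x y \<Longrightarrow> x \<in> V"
    and E_sym: "E x y \<Longrightarrow> E y x"
    and E_irrefl: "\<not> E x x"
    and degree: "x \<in> V \<Longrightarrow> card {y. E x y} = k"
    and common_adj: "E x y \<Longrightarrow> card ({u. E x u} \<inter> {u. E y u}) = l"
    and common_nonadj: "x \<in> V \<Longrightarrow> y \<in> V \<Longrightarrow> x \<noteq> y \<Longrightarrow> \<not> E x y \<Longrightarrow>
      card ({u. E x u} \<inter> {u. E y u}) = m"
begin

definition N :: "'a \<Rightarrow> 'a set" where
  "N x = {y. E x y}"

lemma in_N [simp]: "y \<in> N x \<longleftrightarrow> E x y"
  by (simp add: N_def)

lemma E_in_V2: "E x y \<Longrightarrow> y \<in> V"
  using E_in_V E_sym by blast

lemma N_subset: "N x \<subseteq> V"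
  using E_in_V2 by auto

lemma finite_N [simp]: "finite (N x)"
  using N_subset finite_V finite_subset by blast

lemma card_N: "x \<in> V \<Longrightarrow> card (N x) = k"
  using degree by (simp add: N_def)

lemma card_N_adj: "E x y \<Longrightarrow> card (N x \<inter> N y) = l"
  using common_adj by (simp add: N_def)

lemma card_N_nonadj: "x \<in> V \<Longrightarrow> y \<in> V \<Longrightarrow> x \<noteq> y \<Longrightarrow> \<not> E x y \<Longrightarrow> card (N x \<inter> N y) = m"
  using common_nonadj by (simp add: N_def)

text \<open>The matrix identity \<open>A\<^sup>2 = m J + (k - m) I + (l - m) A\<close> applied to a
  vector \<open>g\<close>: walks of length two from \<open>x\<close> to \<open>u\<close> are counted
  by common neighbours. The ring is arbitrary so that both integer counts and complex eigenvectors
  can be inserted.\<close>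

lemma sum_N_sum_N:
  fixes g :: "'a \<Rightarrow> 'b :: comm_ring_1"
  assumes x: "x \<in> V"
  shows "(\<Sum>y\<in>N x. \<Sum>u\<in>N y. g u) =
    of_nat m * (\<Sum>u\<in>V. g u) + (of_nat k - of_nat m) * g x + (of_nat l - of_nat m) * (\<Sum>u\<in>N x. g u)"
proof -
  have "(\<Sum>y\<in>N x. \<Sum>u\<in>N y. g u) = (\<Sum>y\<in>N x. \<Sum>u\<in>{u\<in>V. E y u}. g u)"
    using E_in_V2 by (intro sum.cong refl) auto
  also have "\<dots> = (\<Sum>u\<in>V. \<Sum>y\<in>{y\<in>N x. E y u}. g u)"
    by (rule sum.swap_restrict) (auto simp: finite_V)
  also have "\<dots> = (\<Sum>u\<in>V. of_nat (card (N x \<inter> N u)) * g u)"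
  proof (intro sum.cong refl)
    fix u
    have "{y \<in> N x. E y u} = N x \<inter> N u" using E_sym by auto
    then show "(\<Sum>y\<in>{y\<in>N x. E y u}. g u) = of_nat (card (N x \<inter> N u)) * g u" by simp
  qed
  also have "\<dots> = (\<Sum>u\<in>V. of_nat m * g u + (if u = x then (of_nat k - of_nat m) * g u else 0)
      + (if E x u then (of_nat l - of_nat m) * g u else 0))"
    using x E_irrefl
    by (intro sum.cong refl) (auto simp: card_N card_N_adj card_N_nonadj algebra_simps)
  also have "\<dots> = of_nat m * (\<Sum>u\<in>V. g u) + (of_nat k - of_nat m) * g x
      + (\<Sum>u\<in>V. if E x u then (of_nat l - of_nat m) * g u else 0)"
    using x finite_V by (simp add: sum.distrib sum_distrib_left)
  also have "(\<Sum>u\<in>V. if E x u then (of_nat l - of_nat m) * g u else 0)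
      = (of_nat l - of_nat m) * (\<Sum>u\<in>N x. g u)"
  proof -
    have "V \<inter> {u. E x u} = N x" using E_in_V2 by auto
    then show ?thesis
      using finite_V by (simp add: sum.If_cases sum_distrib_left)
  qed
  finally show ?thesis .
qed

text \<open>The case where \<open>g\<close> is constantly \<open>1\<close>; it is the identity
  \<open>k (k - l - 1) = m (v - k - 1)\<close> arranged without subtraction.\<close>

lemma parameter_equation:
  assumes "V \<noteq> {}"
  shows "k * k + m * k + m = m * card V + k + l * k"
proof -
  obtain x where x: "x \<in> V" using assms by blast
  have "int k * int k = (\<Sum>y\<in>N x. \<Sum>u\<in>N y. 1)"
    using card_N[OF x] E_in_V2 by (simp add: card_N)
  also have "\<dots> = int m * int (card V) + (int k - int m) + (int l - int m) * int k"
    using sum_N_sum_N[OF x, of "\<lambda>_. 1 :: int"] card_N[OF x] by simp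
  finally have "int (k * k + m * k + m) = int (m * card V + k + l * k)"
    by (simp add: algebra_simps)
  then show ?thesis by linarith
qed

text \<open>Summing the eigenvalue equation over \<open>V\<close> gives
  \<open>e * S = k * S\<close>. Hence \<open>e = k\<close> unless \<open>S = 0\<close>, and then the
  \<open>J\<close> term in \<open>sum_N_sum_N\<close> vanishes and a quadratic equation
  remains.\<close>

lemma eigenvalue_cases:
  fixes g :: "'a \<Rightarrow> complex"
  assumes eig: "\<And>x. x \<in> V \<Longrightarrow> (\<Sum>y\<in>N x. g y) = e * g x"
    and nz: "x0 \<in> V" "g x0 \<noteq> 0"
  shows "e = of_nat k \<or> e\<^sup>2 = (of_nat l - of_nat m) * e + (of_nat k - of_nat m)"
proof -
  define S where "S = (\<Sum>x\<in>V. g x)"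
  have "e * S = (\<Sum>x\<in>V. \<Sum>y\<in>{y\<in>V. E x y}. g y)"
  proof -
    have "{y \<in> V. E x y} = N x" for x using E_in_V2 by auto
    then show ?thesis by (simp add: S_def sum_distrib_left eig)
  qed
  also have "\<dots> = (\<Sum>y\<in>V. \<Sum>x\<in>{x\<in>V. E x y}. g y)"
    by (rule sum.swap_restrict) (auto simp: finite_V)
  also have "\<dots> = of_nat k * S"
  proof -
    have "{x \<in> V. E x y} = N y" for y using E_in_V2 E_sym by auto
    then show ?thesis by (simp add: S_def sum_distrib_left card_N)
  qed
  finally have "e = of_nat k \<or> S = 0" by auto
  moreover have "e\<^sup>2 = (of_nat l - of_nat m) * e + (of_nat k - of_nat m)" if "S = 0"
  proof -
    have "(\<Sum>y\<in>N x0. \<Sum>u\<in>N y. g u) = (\<Sum>y\<in>N x0. e * g y)"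
      using E_in_V2 eig by (intro sum.cong) auto
    also have "\<dots> = e * (e * g x0)" using eig nz by (simp flip: sum_distrib_left)
    finally have "e * (e * g x0) = (of_nat k - of_nat m) * g x0 + (of_nat l - of_nat m) * (e * g x0)"
      using sum_N_sum_N[OF nz(1), of g] that eig nz by (simp add: S_def)
    then have "g x0 * (e\<^sup>2 - ((of_nat l - of_nat m) * e + (of_nat k - of_nat m))) = 0"
      by (simp add: algebra_simps power2_eq_square)
    then show ?thesis using nz by simp
  qed
  ultimately show ?thesis by blast
qed

lemma adjacency_spectrum:
  obtains e :: "nat \<Rightarrow> complex"
  where "\<And>i. i < card V \<Longrightarrow>
      e i = of_nat k \<or> (e i)\<^sup>2 = (of_nat l - of_nat m) * e i + (of_nat k - of_nat m)"
    and "(\<Sum>i<card V. e i) = 0"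
    and "(\<Sum>i<card V. (e i)\<^sup>2) = of_nat (card V * k)"
proof -
  define n where "n = card V"
  obtain f where f: "bij_betw f {..<n} V"
    using ex_bij_betw_nat_finite[OF finite_V] by (auto simp: n_def lessThan_atLeast0)
  then have fV: "f i \<in> V" if "i < n" for i using that bij_betwE by fastforce
  define A :: "complex mat" where "A = mat n n (\<lambda>(i, j). if E (f i) (f j) then 1 else 0)"
  have A: "A \<in> carrier_mat n n" by (simp add: A_def)
  have row_sum: "(\<Sum>j<n. A $$ (i, j) * g (f j)) = (\<Sum>y\<in>N (f i). g y)" if "i < n" for i g
  proof -
    have "(\<Sum>j<n. A $$ (i, j) * g (f j)) = (\<Sum>j<n. if E (f i) (f j) then g (f j) else 0)"
      using that by (intro sum.cong refl) (auto simp: A_def)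
    also have "\<dots> = (\<Sum>y\<in>V. if E (f i) y then g y else 0)"
      by (rule sum.reindex_bij_betw[OF f])
    also have "V \<inter> {y. E (f i) y} = N (f i)" using E_in_V2 by auto
    then have "(\<Sum>y\<in>V. if E (f i) y then g y else 0) = (\<Sum>y\<in>N (f i). g y)"
      using finite_V by (simp add: sum.If_cases)
    finally show ?thesis .
  qed
  obtain e where ev: "\<And>i. i < n \<Longrightarrow> eigenvalue A (e i)"
    and tr: "(\<Sum>i<n. A $$ (i, i)) = (\<Sum>i<n. e i)"
    and tr2: "(\<Sum>i<n. (A * A) $$ (i, i)) = (\<Sum>i<n. (e i)\<^sup>2)"
    using complex_mat_traces[OF A] by blast
  have "e i = of_nat k \<or> (e i)\<^sup>2 = (of_nat l - of_nat m) * e i + (of_nat k - of_nat m)"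
    if i: "i < n" for i
  proof -
    obtain w where w: "w \<in> carrier_vec n" "w \<noteq> 0\<^sub>v n" "A *\<^sub>v w = e i \<cdot>\<^sub>v w"
      using ev[OF i] A unfolding eigenvalue_def eigenvector_def by auto
    \<comment> \<open>The eigenvector, transported from indices to vertices along the enumeration
      \<open>f\<close>.\<close>
    define g where "g x = w $ (the_inv_into {..<n} f x)" for x
    have gf: "g (f j) = w $ j" if "j < n" for j
      using that f by (simp add: g_def the_inv_into_f_f bij_betw_def)
    have eig: "(\<Sum>y\<in>N (f j). g y) = e i * g (f j)" if j: "j < n" for j
    proof -
      have "(A *\<^sub>v w) $ j = (\<Sum>r<n. A $$ (j, r) * g (f r))"
        using j A w(1) by (auto simp: scalar_prod_def lessThan_atLeast0 gf intro!: sum.cong)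
      then show ?thesis using row_sum[OF j, of g] w j by (simp add: gf)
    qed
    obtain j where j: "j < n" "w $ j \<noteq> 0"
      using w(1,2) by (metis carrier_vecD eq_vecI index_zero_vec)
    show ?thesis
    proof (rule eigenvalue_cases[of g "e i" "f j"])
      fix x assume "x \<in> V"
      then obtain r where "r < n" "x = f r" using f by (auto simp: bij_betw_def)
      then show "(\<Sum>y\<in>N x. g y) = e i * g x" using eig by simp
    qed (use j fV gf in auto)
  qed
  moreover have "(\<Sum>i<n. e i) = 0"
    using E_irrefl by (simp flip: tr add: A_def)
  moreover have "(\<Sum>i<n. (e i)\<^sup>2) = of_nat (n * k)"
  proof -
    have "(A * A) $$ (i, i) = of_nat k" if i: "i < n" for i
    proof -
      have "(A * A) $$ (i, i) = (\<Sum>j<n. A $$ (i, j) * A $$ (j, i))"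
        using i A by (auto simp: scalar_prod_def lessThan_atLeast0 intro!: sum.cong)
      also have "\<dots> = (\<Sum>j<n. A $$ (i, j) * (\<lambda>_. 1) (f j))"
        using i E_sym by (intro sum.cong refl) (auto simp: A_def)
      also have "\<dots> = of_nat k" using row_sum[OF i, of "\<lambda>_. 1"] by (simp add: card_N fV i)
      finally show ?thesis .
    qed
    then show ?thesis by (simp flip: tr2)
  qed
  ultimately show thesis using that[of e] by (simp add: n_def)
qed

text \<open>The eigenvalue \<open>k\<close> occurs once, and twice any other eigenvalue is
  \<open>l - m\<close> plus or minus a square root of the discriminant. As the trace is zero, an
  integer multiple of that root is an integer; squaring gives an equation between integers whether
  or not the root is rational.\<close>

lemma rationality_condition:
  assumes m: "m > 0" and V: "V \<noteq> {}"
  obtains c :: int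
  where "(2 * int k + (int (card V) - 1) * (int l - int m))\<^sup>2
    = c\<^sup>2 * ((int l - int m)\<^sup>2 + 4 * (int k - int m))"
proof -
  define n where "n = card V"
  define p where "p t = t\<^sup>2 - (of_nat l - of_nat m) * t - (of_nat k - of_nat m)" for t :: complex
  obtain e :: "nat \<Rightarrow> complex" where
    e0: "\<And>i. i < n \<Longrightarrow>
      e i = of_nat k \<or> (e i)\<^sup>2 = (of_nat l - of_nat m) * e i + (of_nat k - of_nat m)"
    and s1: "(\<Sum>i<n. e i) = 0"
    and s2: "(\<Sum>i<n. (e i)\<^sup>2) = of_nat (n * k)"
    using adjacency_spectrum unfolding n_def by blast
  have e: "e i = of_nat k \<or> p (e i) = 0" if "i < n" for i
    using e0[OF that] by (auto simp: p_def)
  have pk: "p (of_nat k) = of_nat (m * n)"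
  proof -
    have "of_nat (k * k + m * k + m) = (of_nat (m * n + k + l * k) :: complex)"
      using parameter_equation[OF V] by (simp only: n_def)
    then show ?thesis by (simp add: p_def algebra_simps power2_eq_square)
  qed
  define K where "K = {i \<in> {..<n}. e i = of_nat k}"
  have n0: "n > 0" using V finite_V by (simp add: n_def card_gt_0_iff)
  \<comment> \<open>Both ends compute the trace of \<open>p\<close> applied to the adjacency matrix.
    Only the eigenvalue \<open>k\<close> contributes, each time \<open>m * n > 0\<close>, so it
    occurs exactly once.\<close>
  have "of_nat (card K) * of_nat (m * n) = (\<Sum>i\<in>K. p (e i))"
    by (simp add: K_def pk)
  also have "\<dots> = (\<Sum>i<n. p (e i))"
    using e by (intro sum.mono_neutral_left) (auto simp: K_def)
  also have "\<dots> = of_nat (m * n)"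
    using s1 s2 by (simp add: p_def sum_subtractf flip: sum_distrib_left) (simp add: algebra_simps)
  finally have "card K = 1" using m n0 by simp
  then obtain j where K: "K = {j}" by (auto simp: card_1_singleton_iff)
  then have j: "j < n" "e j = of_nat k" by (auto simp: K_def)
  define d where "d = (int l - int m)\<^sup>2 + 4 * (int k - int m)"
  define s where "s = csqrt (of_int d)"
  have s: "s\<^sup>2 = of_int d" by (simp add: s_def)
  define q where "q i = 2 * e i - (of_nat l - of_nat m)" for i
  have q: "q i = s \<or> q i = - s" if "i \<in> {..<n} - {j}" for i
  proof -
    have "p (e i) = 0" using e that K by (auto simp: K_def)
    moreover have "(q i)\<^sup>2 = 4 * p (e i) + s\<^sup>2"
      unfolding s by (simp add: q_def d_def p_def power2_eq_square algebra_simps)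
    ultimately have "(q i)\<^sup>2 = s\<^sup>2" by simp
    then show ?thesis by (simp add: power2_eq_iff)
  qed
  \<comment> \<open>For \<open>s \<noteq> 0\<close> this is the difference of the multiplicities of
    the two remaining eigenvalues.\<close>
  define c :: int where "c = (\<Sum>i\<in>{..<n} - {j}. if q i = s then 1 else -1)"
  have "of_int (if q i = s then 1 else -1) * s = q i" if "i \<in> {..<n} - {j}" for i
    using q[OF that] by auto
  then have "of_int c * s = (\<Sum>i\<in>{..<n} - {j}. q i)"
    unfolding c_def of_int_sum sum_distrib_right by (intro sum.cong refl)
  also have "\<dots> = (\<Sum>i<n. q i) - q j"
    using j by (simp add: sum_diff1)
  also have "\<dots> = - of_int (2 * int k + (int n - 1) * (int l - int m))"
    using s1 j by (simp add: q_def sum_subtractf flip: sum_distrib_left) (simp add: algebra_simps)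
  finally have "of_int c * s = - of_int (2 * int k + (int n - 1) * (int l - int m))" .
  then have "(of_int (2 * int k + (int n - 1) * (int l - int m)) :: complex)\<^sup>2 = (of_int c * s)\<^sup>2"
    by (simp only: power2_minus)
  also have "\<dots> = of_int (c\<^sup>2 * d)" by (simp add: power_mult_distrib s)
  finally have "(2 * int k + (int n - 1) * (int l - int m))\<^sup>2 = c\<^sup>2 * d"
    by (simp only: of_int_eq_iff flip: of_int_power)
  then show thesis unfolding d_def n_def by (rule that)
qed

end

section \<open>Triples over a base vertex\<close>

lemma ex_in_Diff:
  assumes "finite A" "card (A \<inter> B) < card A"
  shows "\<exists>u. u \<in> A \<and> u \<notin> B"
  using assms by (metis inf.absorb1 less_irrefl subsetI)

lemma card_Int_Un:
  assumes "finite A"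
  shows "card (A \<inter> (B \<union> C)) + card (A \<inter> B \<inter> C) = card (A \<inter> B) + card (A \<inter> C)"
proof -
  have "A \<inter> (B \<union> C) = (A \<inter> B) \<union> (A \<inter> C)" "A \<inter> B \<inter> C = (A \<inter> B) \<inter> (A \<inter> C)" by auto
  then show ?thesis using card_Un_Int[of "A \<inter> B" "A \<inter> C"] assms by simp
qed

text \<open>The relation is a parameter because shattering is also needed for "non-adjacent and
  distinct", the adjacency of the complement.\<close>

definition shatters :: "'a set \<Rightarrow> ('a \<Rightarrow> 'a \<Rightarrow> bool) \<Rightarrow> 'a set \<Rightarrow> bool" where
  "shatters V R S \<longleftrightarrow> (\<forall>A\<subseteq>S. \<exists>u\<in>V. {s \<in> S. R u s} = A)"

lemma shatters_tripleI:
  assumes "\<exists>u\<in>V. R u x \<and> R u y \<and> R u z"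
    and "\<exists>u\<in>V. R u x \<and> R u y \<and> \<not> R u z"
    and "\<exists>u\<in>V. R u x \<and> \<not> R u y \<and> R u z"
    and "\<exists>u\<in>V. \<not> R u x \<and> R u y \<and> R u z"
    and "\<exists>u\<in>V. R u x \<and> \<not> R u y \<and> \<not> R u z"
    and "\<exists>u\<in>V. \<not> R u x \<and> R u y \<and> \<not> R u z"
    and "\<exists>u\<in>V. \<not> R u x \<and> \<not> R u y \<and> R u z"
    and "\<exists>u\<in>V. \<not> R u x \<and> \<not> R u y \<and> \<not> R u z"
  shows "shatters V R {x, y, z}"
  unfolding shatters_def
proof (intro allI impI)
  fix A assume A: "A \<subseteq> {x, y, z}"
  have "\<exists>u\<in>V. (R u x \<longleftrightarrow> x \<in> A) \<and> (R u y \<longleftrightarrow> y \<in> A) \<and> (R u z \<longleftrightarrow> z \<in> A)"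
    using assms by (cases "x \<in> A"; cases "y \<in> A"; cases "z \<in> A") simp_all
  then obtain u where "u \<in> V" "R u x \<longleftrightarrow> x \<in> A" "R u y \<longleftrightarrow> y \<in> A" "R u z \<longleftrightarrow> z \<in> A" by blast
  with A have "{s \<in> {x, y, z}. R u s} = A" by blast
  with \<open>u \<in> V\<close> show "\<exists>u\<in>V. {s \<in> {x, y, z}. R u s} = A" by blast
qed

context srg
begin

section \<open>The blocks \<open>N y \<inter> N z\<close> of the non-neighbours \<open>y\<close> of
  \<open>z\<close>\<close>

definition far :: "'a \<Rightarrow> 'a set" where
  "far z = V - insert z (N z)"

lemma in_far [simp]: "y \<in> far z \<longleftrightarrow> y \<in> V \<and> y \<noteq> z \<and> \<not> E z y"
  by (auto simp: far_def)

lemma finite_far [simp]: "finite (far z)"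
  using finite_V by (simp add: far_def)

lemma card_N_far: "z \<in> V \<Longrightarrow> y \<in> far z \<Longrightarrow> card (N y \<inter> N z) = m"
  using card_N_nonadj E_sym by (metis in_far)

lemma card_N_Diff_far:
  assumes "z \<in> V" "y \<in> far z"
  shows "card (N y - N z) = k - m"
  using assms card_N_far card_N by (simp add: card_Diff_subset_Int)

lemma N_Diff_far: "y \<in> far z \<Longrightarrow> N y - N z \<subseteq> far z"
  using E_in_V2 E_sym by auto

lemma card_common_split:
  "card (N x \<inter> N y) = card (N x \<inter> N y \<inter> N z) + card ((N x - N z) \<inter> (N y - N z))"
proof -
  have "N x \<inter> N y = (N x \<inter> N y \<inter> N z) \<union> ((N x - N z) \<inter> (N y - N z))" by auto
  then show ?thesis
    by (metis (no_types, lifting) Diff_disjoint Int_Diff card_Un_disjoint finite_Diff finite_Int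
        finite_N inf_assoc inf_bot_right inf_left_commute)
qed

lemma card_triple_Un:
  assumes "z \<in> V" "x \<in> far z" "y \<in> far z"
  shows "card (N z \<inter> (N x \<union> N y)) + card (N x \<inter> N y \<inter> N z) = 2 * m"
  using card_Int_Un[of "N z" "N x" "N y"] card_N_far[of z x] card_N_far[of z y] assms
  by (simp add: Int_ac)

text \<open>Both blocks have size \<open>m\<close> and lie in \<open>N z\<close>, so their union has
  at most \<open>k\<close> elements.\<close>

lemma card_triple_ge:
  assumes "z \<in> V" "x \<in> far z" "y \<in> far z"
  shows "2 * m \<le> card (N x \<inter> N y \<inter> N z) + k"
proof -
  have "card (N z \<inter> (N x \<union> N y)) \<le> k"
    using card_mono[of "N z" "N z \<inter> (N x \<union> N y)"] card_N assms by auto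
  then show ?thesis using card_triple_Un[OF assms] by linarith
qed

lemma card_triple_le:
  assumes "z \<in> V" "x \<in> far z" "y \<in> far z"
  shows "card (N x \<inter> N y \<inter> N z) \<le> m"
proof -
  have "card (N x \<inter> N y \<inter> N z) \<le> card (N x \<inter> N z)" by (intro card_mono) auto
  then show ?thesis using card_N_far assms by simp
qed

lemma card_triple_le_common: "card (N x \<inter> N y \<inter> N z) \<le> card (N x \<inter> N y)"
  by (intro card_mono) auto

lemma triple_eq:
  assumes "z \<in> V" "x \<in> far z" "y \<in> far z" and t: "card (N x \<inter> N y \<inter> N z) = m"
  shows "N x \<inter> N z = N y \<inter> N z"
proof -
  have "N x \<inter> N y \<inter> N z = N x \<inter> N z" "N x \<inter> N y \<inter> N z = N y \<inter> N z"
    using t card_N_far assms by (intro card_subset_eq; auto)+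
  then show ?thesis by simp
qed

lemma triple_eq_iff:
  assumes "z \<in> V" "x \<in> far z" "y \<in> far z"
  shows "card (N x \<inter> N y \<inter> N z) = m \<longleftrightarrow> N x \<inter> N z = N y \<inter> N z"
proof
  assume "N x \<inter> N z = N y \<inter> N z"
  then have "N x \<inter> N y \<inter> N z = N x \<inter> N z" by auto
  then show "card (N x \<inter> N y \<inter> N z) = m" using card_N_far assms by simp
qed (use triple_eq assms in blast)

text \<open>\<open>N w\<close> consists of \<open>z\<close>, the \<open>l\<close> common neighbours
  of \<open>z\<close> and \<open>w\<close>, and its part in \<open>far z\<close>.\<close>

lemma card_N_Int_far:
  assumes "E z w"
  shows "card (N w \<inter> far z) + l + 1 = k"
proof -
  have eq: "N w = insert z (N w \<inter> N z) \<union> (N w \<inter> far z)"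
    using assms E_sym E_in_V2 by auto
  have "card (N w) = card (insert z (N w \<inter> N z)) + card (N w \<inter> far z)"
    by (subst eq, rule card_Un_disjoint) (auto simp: E_irrefl)
  moreover have "card (insert z (N w \<inter> N z)) = l + 1"
    using assms E_irrefl E_sym card_N_adj by simp
  ultimately show ?thesis using assms card_N E_in_V2 by auto
qed

lemma card_far:
  assumes "z \<in> V"
  shows "card (far z) + k + 1 = card V"
proof -
  have "card (V - insert z (N z)) = card V - card (insert z (N z))"
    using assms N_subset by (intro card_Diff_subset) auto
  moreover have "card (insert z (N z)) = k + 1" using assms card_N E_irrefl by simp
  moreover have "card (insert z (N z)) \<le> card V"
    using assms N_subset finite_V by (intro card_mono) auto
  ultimately show ?thesis by (simp add: far_def)
qed

text \<open>
  The four inequalities say that the patterns \<open>{x, y, z}\<close>, \<open>{x, z}\<close> and \<open>{y, z}\<close>, \<open>{x, y}\<close>,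
  and \<open>{z}\<close> occur; the patterns \<open>{x}\<close> and \<open>{y}\<close> are realised by \<open>y\<close> and \<open>x\<close> if
  these are adjacent, and by the last inequality otherwise.
\<close>

lemma shatters_far_triple:
  assumes z: "z \<in> V" and x: "x \<in> far z" and y: "y \<in> far z" and "x \<noteq> y"
    and t: "card (N x \<inter> N y \<inter> N z) = t"
    and t0: "0 < t" and tm: "t < m" and tc: "t < card (N x \<inter> N y)" and tk: "2 * m < k + t"
  shows "shatters V E {x, y, z}"
proof -
  have V: "x \<in> V" "y \<in> V" and xz: "x \<noteq> z" "y \<noteq> z" "\<not> E z x" "\<not> E z y" "\<not> E x z" "\<not> E y z"
    using x y E_sym by auto
  \<comment> \<open>\<open>N b\<close> and \<open>N c\<close> together cover
    \<open>2 * m - t\<close> vertices of \<open>N a\<close>, fewer than \<open>k\<close>.\<close>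
  have one: "\<exists>u. u \<in> N a \<and> u \<notin> N b \<union> N c"
    if "a \<in> V" "card (N a \<inter> N b) = m" "card (N a \<inter> N c) = m" "N a \<inter> N b \<inter> N c = N x \<inter> N y \<inter> N z"
    for a b c
    using card_Int_Un[of "N a" "N b" "N c"] that t tk card_N by (intro ex_in_Diff) auto
  have two: "\<exists>u. u \<in> N a \<inter> N b \<and> u \<notin> N c"
    if "t < card (N a \<inter> N b)" "N a \<inter> N b \<inter> N c = N x \<inter> N y \<inter> N z" for a b c
    using that t by (intro ex_in_Diff) auto
  have c: "card (N x \<inter> N z) = m" "card (N y \<inter> N z) = m" "card (N z \<inter> N x) = m" "card (N z \<inter> N y) = m"
    using card_N_far[OF z x] card_N_far[OF z y] by (simp_all add: Int_commute)
  have "N x \<inter> N y \<inter> N z \<noteq> {}" using t t0 by auto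
  then obtain u where "u \<in> N x \<inter> N y \<inter> N z" by blast
  then have full: "\<exists>u\<in>V. E u x \<and> E u y \<and> E u z"
    using E_sym E_in_V2 by (intro bexI[of _ u]) auto
  have pairs: "\<exists>u\<in>V. E u x \<and> E u y \<and> \<not> E u z" "\<exists>u\<in>V. E u x \<and> \<not> E u y \<and> E u z"
    "\<exists>u\<in>V. \<not> E u x \<and> E u y \<and> E u z"
    using two[of x y z] two[of x z y] two[of y z x] tc tm c E_sym E_in_V2
    by (simp_all add: Int_ac) blast+
  have "\<exists>u. u \<in> N z \<and> u \<notin> N x \<union> N y" using one[of z x y] z c by (simp add: Int_ac)
  then have single: "\<exists>u\<in>V. \<not> E u x \<and> \<not> E u y \<and> E u z" using E_sym E_in_V2 by auto blast
  have "\<exists>u\<in>V. E u x \<and> \<not> E u y \<and> \<not> E u z"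
  proof (cases "E x y")
    case True
    then show ?thesis using V xz E_sym E_irrefl by blast
  next
    case False
    then have "card (N x \<inter> N y) = m"
      using card_N_nonadj[OF V] \<open>x \<noteq> y\<close> by simp
    then obtain u where "u \<in> N x" "u \<notin> N y \<union> N z" using one[of x y z] V c by auto
    then show ?thesis using E_sym E_in_V2 by (intro bexI[of _ u]) auto
  qed
  moreover have "\<exists>u\<in>V. \<not> E u x \<and> E u y \<and> \<not> E u z"
  proof (cases "E x y")
    case True
    then show ?thesis using V xz E_irrefl by blast
  next
    case False
    then have "card (N y \<inter> N x) = m"
      using card_N_nonadj[OF V] \<open>x \<noteq> y\<close> by (simp add: Int_commute)
    moreover have "N y \<inter> N x \<inter> N z = N x \<inter> N y \<inter> N z" by auto
    ultimately obtain u where "u \<in> N y" "u \<notin> N x \<union> N z" using one[of y x z] V c by auto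
    then show ?thesis using E_sym E_in_V2 by (intro bexI[of _ u]) auto
  qed
  \<comment> \<open>The empty pattern is that of \<open>z\<close> itself.\<close>
  moreover have "\<exists>u\<in>V. \<not> E u x \<and> \<not> E u y \<and> \<not> E u z" using z xz E_irrefl by blast
  ultimately show ?thesis using full pairs single by (intro shatters_tripleI)
qed

end

section \<open>Graphs without shattered triples\<close>

text \<open>Primitivity enters the counting through these inequalities: connectedness of the graph
  yields \<open>0 < m\<close> and \<open>l + 1 < k\<close>, that of the complement yields
  \<open>m < k\<close>.\<close>

locale primitive_srg = srg +
  assumes V_nonempty: "V \<noteq> {}"
    and m_pos: "0 < m"
    and m_less: "m < k"
    and l_less: "l + 1 < k"
begin

lemma obtain_far_neighbour:
  assumes "E z w"
  obtains y where "y \<in> far z" "E w y"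
proof -
  have "card (N w \<inter> far z) \<noteq> 0" using card_N_Int_far[OF assms] l_less by linarith
  then have "N w \<inter> far z \<noteq> {}" by (metis card.empty)
  then obtain y where "y \<in> N w \<inter> far z" by blast
  then show thesis using that[of y] by simp
qed

lemma obtain_neighbour:
  assumes "z \<in> V" obtains w where "E z w"
proof -
  have "card (N z) \<noteq> 0" using card_N[OF assms] m_less by simp
  then have "N z \<noteq> {}" by (metis card.empty)
  then obtain w where "w \<in> N z" by blast
  then show thesis using that by simp
qed

text \<open>Take a path \<open>z\<close>, \<open>w\<close>, \<open>y\<close> with \<open>z\<close>
  and \<open>y\<close> non-adjacent. In \<open>N w\<close>, the \<open>l\<close> neighbours of
  \<open>z\<close> and the \<open>l\<close> neighbours of \<open>y\<close> avoid \<open>z\<close>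
  and \<open>y\<close>, and they overlap in at most the \<open>m - 1\<close> common neighbours of
  \<open>z\<close> and \<open>y\<close> other than \<open>w\<close>. So \<open>2 l\<close> is at
  most \<open>(k - 2) + (m - 1)\<close>.\<close>

lemma l_bound: "2 * l + 3 \<le> k + m"
proof -
  obtain z where z: "z \<in> V" using V_nonempty by auto
  obtain w where w: "E z w" using obtain_neighbour[OF z] .
  obtain y where y: "y \<in> far z" "E w y" using obtain_far_neighbour[OF w] .
  have wV: "w \<in> V" using w E_in_V2 by auto
  have "card (N w \<inter> (N z \<union> N y)) + card (N w \<inter> N z \<inter> N y) = 2 * l"
    using card_Int_Un[of "N w" "N z" "N y"] card_N_adj[OF E_sym[OF w]] card_N_adj[OF y(2)] by simp
  moreover have "card (N w \<inter> (N z \<union> N y)) \<le> card (N w - {z, y})"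
    using y E_irrefl E_sym by (intro card_mono) auto
  moreover have "card (N w - {z, y}) = k - 2"
    using y w wV E_sym card_N by (subst card_Diff_subset) auto
  moreover have "card (N w \<inter> N z \<inter> N y) \<le> card (N y \<inter> N z - {w})"
    using E_irrefl by (intro card_mono) auto
  moreover have "card (N y \<inter> N z - {w}) = m - 1"
    using y w E_sym card_N_far[OF z y(1)] by (subst card_Diff_subset) auto
  ultimately show ?thesis using m_pos l_less by linarith
qed

end

locale no_shattered_triple = primitive_srg +
  assumes no_triple: "x \<in> V \<Longrightarrow> y \<in> V \<Longrightarrow> z \<in> V \<Longrightarrow> x \<noteq> y \<Longrightarrow> x \<noteq> z \<Longrightarrow> y \<noteq> z \<Longrightarrow>
      \<not> shatters V E {x, y, z}"
begin

text \<open>Contrapositive of \<open>shatters_far_triple\<close>: when one of its four strict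
  inequalities fails, the general bound in the same direction is attained.\<close>

lemma triple_cases:
  assumes z: "z \<in> V" and x: "x \<in> far z" and y: "y \<in> far z" and "x \<noteq> y"
  shows "card (N x \<inter> N y \<inter> N z) = 0 \<or> card (N x \<inter> N y \<inter> N z) = m \<or>
    card (N x \<inter> N y \<inter> N z) = card (N x \<inter> N y) \<or> card (N x \<inter> N y \<inter> N z) + k = 2 * m"
proof -
  define t where "t = card (N x \<inter> N y \<inter> N z)"
  have "\<not> shatters V E {x, y, z}" using no_triple[of x y z] assms by auto
  then have "\<not> (0 < t \<and> t < m \<and> t < card (N x \<inter> N y) \<and> 2 * m < k + t)"
    using shatters_far_triple[OF z x y \<open>x \<noteq> y\<close> t_def[symmetric]] by blast
  moreover have "2 * m \<le> t + k" "t \<le> m" "t \<le> card (N x \<inter> N y)"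
    using card_triple_ge[OF z x y] card_triple_le[OF z x y] card_triple_le_common[of x y z]
    by (simp_all add: t_def)
  ultimately show ?thesis unfolding t_def[symmetric] by linarith
qed

text \<open>
  Adjacent non-neighbours of \<open>z\<close> have the same block, and non-adjacent ones with different
  blocks have the same neighbours outside \<open>N z\<close>; such a neighbour would have both blocks.
\<close>

lemma not_dense_adjacent:
  assumes "k \<le> 2 * m"
  shows "l < m"
proof (rule ccontr)
  assume "\<not> l < m"
  then have lm: "m \<le> l" by simp
  obtain z where z: "z \<in> V" using V_nonempty by auto
  have t: "N y \<inter> N z = N y' \<inter> N z \<or> card (N y \<inter> N y' \<inter> N z) + k = 2 * m"
    if y: "y \<in> far z" "y' \<in> far z" for y y'
  proof (cases "y = y'")
    case False
    have "card (N y \<inter> N y') \<ge> m"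
      using y lm card_N_adj[of y y'] card_N_nonadj[of y y'] False by (cases "E y y'") auto
    then have "card (N y \<inter> N y' \<inter> N z) = m \<or> card (N y \<inter> N y' \<inter> N z) + k = 2 * m"
      using triple_cases[OF z y False] card_triple_ge[OF z y] card_triple_le[OF z y] assms
      by linarith
    then show ?thesis using triple_eq[OF z y] by blast
  qed simp
  have Q: "card ((N y - N z) \<inter> (N y' - N z)) + 2 * m = card (N y \<inter> N y') + k"
    if y: "y \<in> far z" "y' \<in> far z" and "N y \<inter> N z \<noteq> N y' \<inter> N z" for y y'
    using t[OF y] that card_common_split[of y y' z] by linarith
  \<comment> \<open>If the blocks of two adjacent vertices differ, \<open>m \<le> l\<close> makes
    their common neighbours outside \<open>N z\<close> fill \<open>N y - N z\<close>; but
    \<open>y'\<close> lies in that set and is not its own neighbour.\<close>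
  have adj: "N y \<inter> N z = N y' \<inter> N z" if y: "y \<in> far z" "y' \<in> far z" and E: "E y y'" for y y'
  proof (rule ccontr)
    assume ne: "N y \<inter> N z \<noteq> N y' \<inter> N z"
    have "card ((N y - N z) \<inter> (N y' - N z)) \<ge> card (N y - N z)"
      using Q[OF y ne] card_N_adj[OF E] lm card_N_Diff_far[OF z y(1)] by linarith
    then have "(N y - N z) \<inter> (N y' - N z) = N y - N z"
      by (intro card_seteq) auto
    moreover have "y' \<in> N y - N z" using y E by auto
    ultimately have "y' \<in> N y'" by blast
    then show False using E_irrefl by simp
  qed
  obtain w where w: "E z w" using obtain_neighbour[OF z] .
  obtain y where y: "y \<in> far z" using obtain_far_neighbour[OF w] .
  \<comment> \<open>A vertex of \<open>N z\<close> outside the block of \<open>y\<close> has a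
    neighbour in \<open>far z\<close>, and the block of that neighbour is a different one.\<close>
  have "\<exists>w. w \<in> N z \<and> w \<notin> N y"
    using card_N_far[OF z y] card_N[OF z] m_less by (intro ex_in_Diff) (auto simp: Int_commute)
  then obtain w' where w': "E z w'" "\<not> E y w'" by auto
  obtain y' where y': "y' \<in> far z" "E w' y'" using obtain_far_neighbour[OF w'(1)] .
  have ne: "N y \<inter> N z \<noteq> N y' \<inter> N z" using w' y' E_sym by auto
  then have "y \<noteq> y'" "\<not> E y y'" using adj y y' by auto
  then have "card ((N y - N z) \<inter> (N y' - N z)) \<noteq> 0"
    using Q[OF y y'(1) ne] card_N_nonadj[of y y'] y y' m_less by auto
  then have "(N y - N z) \<inter> (N y' - N z) \<noteq> {}" by (metis card.empty)
  then obtain u where u: "E y u" "E y' u" "\<not> E z u" by auto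
  then have "u \<in> far z" using N_Diff_far[OF y] by auto
  then show False using adj[OF y _ u(1)] adj[OF y'(1) _ u(2)] ne by simp
qed

text \<open>
  The blocks are disjoint or equal.  Points of one block share all their neighbours in
  \<open>far z\<close>, which forces \<open>k + 3 \<le> 3 m\<close>; but there are three disjoint blocks in \<open>N z\<close>.
\<close>

lemma not_sparse_adjacent:
  assumes m: "2 \<le> m" and mk: "2 * m < k"
  shows "l < m"
proof (rule ccontr)
  assume "\<not> l < m"
  then have lm: "m \<le> l" by simp
  obtain z where z: "z \<in> V" using V_nonempty by auto
  have eq: "N y \<inter> N z = N y' \<inter> N z" if y: "y \<in> far z" "y' \<in> far z" and w: "w \<in> N y \<inter> N y' \<inter> N z" for y y' w
  proof (cases "y = y'")
    case False
    have "card (N y \<inter> N y') \<ge> m"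
      using y lm card_N_adj[of y y'] card_N_nonadj[of y y'] False by (cases "E y y'") auto
    moreover have "card (N y \<inter> N y' \<inter> N z) \<noteq> 0" using w by auto
    ultimately have "card (N y \<inter> N y' \<inter> N z) = m"
      using triple_cases[OF z y False] card_triple_le[OF z y] mk by linarith
    then show ?thesis using triple_eq[OF z y] by simp
  qed simp
  have disj: "N y \<inter> N y' \<inter> N z = {}"
    if "y \<in> far z" "y' \<in> far z" "w \<in> N z" "w \<in> N y'" "w \<notin> N y" for y y' w
    using eq[OF that(1,2)] that by blast
  obtain w0 where w0: "E z w0" using obtain_neighbour[OF z] .
  obtain y1 where y1: "y1 \<in> far z" using obtain_far_neighbour[OF w0] .
  define B where "B = N y1 \<inter> N z"
  have cB: "card B = m" using card_N_far[OF z y1] by (simp add: B_def)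
  \<comment> \<open>A neighbour of \<open>w\<close> in \<open>far z\<close> shares \<open>w\<close>
    with \<open>y1\<close>, so its block is \<open>B\<close> and it is also adjacent to
    \<open>w'\<close>.\<close>
  have sub: "insert z (N w \<inter> far z) \<subseteq> N w \<inter> N w'" if "w \<in> B" "w' \<in> B" for w w'
  proof -
    have "E w' y" if y: "y \<in> N w \<inter> far z" for y
    proof -
      have "w \<in> N y \<inter> N y1 \<inter> N z" using y \<open>w \<in> B\<close> E_sym by (auto simp: B_def)
      then have "N y \<inter> N z = N y1 \<inter> N z" using eq y y1 by blast
      then have "w' \<in> N y" using \<open>w' \<in> B\<close> unfolding B_def by blast
      then show ?thesis using E_sym by simp
    qed
    then show ?thesis using that E_sym by (auto simp: B_def)
  qed
  have csub: "card (insert z (N w \<inter> far z)) + l = k" if "w \<in> B" for w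
    using card_N_Int_far[of z w] that by (simp add: B_def)
  \<comment> \<open>By \<open>sub\<close>, two points of \<open>B\<close> have at least
    \<open>k - l\<close> common neighbours. If they are non-adjacent, this is at most
    \<open>m\<close>. If instead \<open>B\<close> is a clique, its other \<open>m - 2\<close> points
    are further common neighbours, so \<open>k - l + (m - 2) \<le> l\<close>, against
    \<open>l_bound\<close>.\<close>
  have "k \<le> l + m"
  proof (cases "\<exists>w\<in>B. \<exists>w'\<in>B. w \<noteq> w' \<and> \<not> E w w'")
    case True
    then obtain w w' where w: "w \<in> B" "w' \<in> B" "w \<noteq> w'" "\<not> E w w'" by blast
    then have "w \<in> V" "w' \<in> V" using E_in_V2 by (auto simp: B_def)
    then have "card (N w \<inter> N w') = m" using card_N_nonadj w by simp
    then show ?thesis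
      using card_mono[OF _ sub[OF w(1,2)]] csub[OF w(1)] by simp
  next
    case False
    obtain w w' where w: "w \<in> B" "w' \<in> B" "w \<noteq> w'"
      using m cB by (metis card_2_iff insert_subset obtain_subset_with_card_n)
    have adj: "E a b" if "a \<in> B" "b \<in> B" "a \<noteq> b" for a b
      using False that by blast
    have "B - {w, w'} \<subseteq> N w \<inter> N w'"
    proof
      fix x assume "x \<in> B - {w, w'}"
      then have "E w x" "E w' x" using adj[of w x] adj[of w' x] w by auto
      then show "x \<in> N w \<inter> N w'" by simp
    qed
    then have "insert z (N w \<inter> far z) \<union> (B - {w, w'}) \<subseteq> N w \<inter> N w'"
      using sub[OF w(1,2)] by blast
    then have "card (insert z (N w \<inter> far z) \<union> (B - {w, w'})) \<le> card (N w \<inter> N w')"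
      by (intro card_mono) auto
    moreover have "card (N w \<inter> N w') = l" using card_N_adj[OF adj] w by simp
    moreover have "card (insert z (N w \<inter> far z) \<union> (B - {w, w'}))
        = card (insert z (N w \<inter> far z)) + card (B - {w, w'})"
      by (rule card_Un_disjoint) (auto simp: B_def E_irrefl)
    moreover have "card (B - {w, w'}) = m - 2"
      using w cB by (subst card_Diff_subset) auto
    ultimately have False using csub[OF w(1)] l_bound m by linarith
    then show ?thesis ..
  qed
  then have "k + 3 \<le> 3 * m" using l_bound by linarith
  have "\<exists>w. w \<in> N z \<and> w \<notin> N y1"
    using card_N_far[OF z y1] card_N[OF z] m_less by (intro ex_in_Diff) (auto simp: Int_commute)
  then obtain w2 where w2: "E z w2" "\<not> E y1 w2" by auto
  obtain y2 where y2: "y2 \<in> far z" "E w2 y2" using obtain_far_neighbour[OF w2(1)] .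
  have d12: "N y1 \<inter> N y2 \<inter> N z = {}" using disj[of y1 y2 w2] y1 y2 w2 E_sym by auto
  have c12: "card (N z \<inter> (N y1 \<union> N y2)) = 2 * m"
    using card_triple_Un[OF z y1 y2(1)] d12 by simp
  then have "\<exists>w. w \<in> N z \<and> w \<notin> N y1 \<union> N y2"
    using card_N[OF z] mk by (intro ex_in_Diff) auto
  then obtain w3 where w3: "E z w3" "\<not> E y1 w3" "\<not> E y2 w3" by auto
  obtain y3 where y3: "y3 \<in> far z" "E w3 y3" using obtain_far_neighbour[OF w3(1)] .
  have "N y1 \<inter> N y3 \<inter> N z = {}" "N y2 \<inter> N y3 \<inter> N z = {}"
    using disj[of _ y3 w3] y1 y2 y3 w3 E_sym by auto
  then have "card (N z \<inter> (N y1 \<union> N y2) \<union> (N y3 \<inter> N z))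
      = card (N z \<inter> (N y1 \<union> N y2)) + card (N y3 \<inter> N z)"
    by (intro card_Un_disjoint) auto
  moreover have "card (N z \<inter> (N y1 \<union> N y2) \<union> (N y3 \<inter> N z)) \<le> card (N z)"
    by (intro card_mono) auto
  ultimately show False
    using c12 card_N_far[OF z y3(1)] card_N[OF z] \<open>k + 3 \<le> 3 * m\<close> by linarith
qed

text \<open>Common neighbours of members of \<open>M\<close> lie in \<open>N z\<close>. Hence
  non-adjacent members have equal blocks, adjacent ones different blocks because
  \<open>l < m\<close>, and no member is adjacent to two others, as it would be a common neighbour
  in \<open>far z\<close>. Given an edge in \<open>M\<close>, a third member is therefore adjacent
  to neither end and has the block of both, which is absurd.\<close>

lemma far_class:
  assumes lm: "l < m" and z: "z \<in> V" and M: "M \<subseteq> far z" "3 \<le> card M"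
    and common: "\<And>y y'. y \<in> M \<Longrightarrow> y' \<in> M \<Longrightarrow> y \<noteq> y' \<Longrightarrow>
      card (N y \<inter> N y' \<inter> N z) = card (N y \<inter> N y')"
    and y: "y \<in> M" "y' \<in> M" "y \<noteq> y'"
  shows "\<not> E y y'" and "N y \<inter> N z = N y' \<inter> N z"
proof -
  have sub: "N y \<inter> N y' \<subseteq> N z" if "y \<in> M" "y' \<in> M" "y \<noteq> y'" for y y'
  proof -
    have "N y \<inter> N y' \<inter> N z = N y \<inter> N y'"
      using common[OF that] by (intro card_subset_eq) auto
    then show ?thesis by auto
  qed
  have nonadj_eq: "N y \<inter> N z = N y' \<inter> N z" if "y \<in> M" "y' \<in> M" "y \<noteq> y'" "\<not> E y y'" for y y'
    using common[OF that(1-3)] card_N_nonadj[of y y'] triple_eq[OF z, of y y'] that M by fastforce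
  have adj_neq: "N y \<inter> N z \<noteq> N y' \<inter> N z" if "y \<in> M" "y' \<in> M" "E y y'" for y y'
    using common[OF that(1,2)] card_N_adj[OF that(3)] triple_eq_iff[OF z, of y y'] that M lm E_irrefl
    by (metis less_irrefl subsetD)
  have nadj: "\<not> E a b" if ab: "a \<in> M" "b \<in> M" for a b
  proof
    assume E: "E a b"
    have "\<not> M \<subseteq> {a, b}"
    proof
      assume "M \<subseteq> {a, b}"
      then have "card M \<le> card {a, b}" by (intro card_mono) auto
      also have "\<dots> \<le> 2" by (simp add: card_insert_if)
      finally show False using M by simp
    qed
    then obtain c where c: "c \<in> M" "c \<noteq> a" "c \<noteq> b" by auto
    have far: "\<not> E z x" if "x \<in> M" for x using that M by auto
    have ne: "a \<noteq> b" using E E_irrefl by blast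
    have *: False if "\<not> E c x" "x \<in> M" "x' \<in> M" "E x x'" "c \<noteq> x" "c \<noteq> x'" for x x'
    proof (cases "E c x'")
      case True
      then have "x' \<in> N c \<inter> N x" using that by auto
      then have "x' \<in> N z" using sub[OF c(1) \<open>x \<in> M\<close> \<open>c \<noteq> x\<close>] by blast
      then show False using far[OF \<open>x' \<in> M\<close>] by simp
    next
      case False
      then show False using nonadj_eq[of c x] nonadj_eq[of c x'] adj_neq[of x x'] that c by auto
    qed
    have "\<not> E c a \<or> \<not> E c b"
    proof (rule ccontr)
      assume "\<not> ?thesis"
      then have "c \<in> N a \<inter> N b" using E_sym by auto
      then have "c \<in> N z" using sub[OF ab ne] by blast
      then show False using far[OF c(1)] by simp
    qed
    then show False using *[of a b] *[of b a] ab c E E_sym by blast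
  qed
  show "\<not> E y y'" using nadj y by blast
  then show "N y \<inter> N z = N y' \<inter> N z" using nonadj_eq y by blast
qed

text \<open>If \<open>l < m\<close>, the neighbours in \<open>far z\<close> of a vertex
  \<open>w\<close> of \<open>N z\<close> meet the hypotheses of \<open>far_class\<close>, since
  \<open>w\<close> keeps their triple intersections nonempty. They share one block, and a second
  point \<open>w'\<close> of it has \<open>k - l\<close> common neighbours with \<open>w\<close>,
  which is more than \<open>m\<close>.\<close>

lemma not_sparse_nonadjacent:
  assumes m: "2 \<le> m" and mk: "2 * m \<le> k" and k: "6 \<le> k"
  shows "m \<le> l"
proof (rule ccontr)
  assume "\<not> m \<le> l"
  then have lm: "l < m" by simp
  obtain z where z: "z \<in> V" using V_nonempty by auto
  \<comment> \<open>Here \<open>k - l - 1 \<ge> k - m\<close>, and this is at least half of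
    \<open>k\<close>; hence the bound \<open>6 \<le> k\<close>.\<close>
  have M3: "3 \<le> card (N w \<inter> far z)" if "E z w" for w
    using card_N_Int_far[OF that] lm mk k by linarith
  have common: "card (N y \<inter> N y' \<inter> N z) = card (N y \<inter> N y')"
    if w: "E z w" and y: "y \<in> N w \<inter> far z" "y' \<in> N w \<inter> far z" and ne: "y \<noteq> y'" for w y y'
  proof -
    have far: "y \<in> far z" "y' \<in> far z" using y by auto
    have "w \<in> N y \<inter> N y' \<inter> N z" using w y E_sym by auto
    then have pos: "card (N y \<inter> N y' \<inter> N z) \<noteq> 0" by (auto simp: card_eq_0_iff)
    have "card (N y \<inter> N y') \<le> m"
      using far lm card_N_adj[of y y'] card_N_nonadj[of y y'] ne by (cases "E y y'") auto
    then show ?thesis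
      using triple_cases[OF z far ne] card_triple_le_common[of y y' z] pos mk by linarith
  qed
  have eq: "N y \<inter> N z = N y' \<inter> N z"
    if "E z w" "y \<in> N w \<inter> far z" "y' \<in> N w \<inter> far z" for w y y'
    using far_class(2)[OF lm z _ M3[OF that(1)] common[OF that(1)], of y y'] that by blast
  obtain w where w: "E z w" using obtain_neighbour[OF z] .
  obtain y where y: "y \<in> far z" "E w y" using obtain_far_neighbour[OF w] .
  have "card (N y \<inter> N z - {w}) \<noteq> 0"
    using card_N_far[OF z y(1)] y w m E_sym by (subst card_Diff_subset) auto
  then have "N y \<inter> N z - {w} \<noteq> {}" by (metis card.empty)
  then obtain w' where "w' \<in> N y \<inter> N z - {w}" by blast
  then have w': "E y w'" "E z w'" "w' \<noteq> w" by auto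
  have "insert z (N w \<inter> far z) \<subseteq> N w \<inter> N w'"
  proof -
    have "E w' y'" if "y' \<in> N w \<inter> far z" for y'
    proof -
      have "N y' \<inter> N z = N y \<inter> N z" using eq[OF w that, of y] y by simp
      then have "w' \<in> N y'" using w' by (metis IntE IntI in_N)
      then show ?thesis using E_sym by simp
    qed
    then show ?thesis using w w' E_sym by auto
  qed
  then have "card (insert z (N w \<inter> far z)) \<le> card (N w \<inter> N w')" by (intro card_mono) auto
  moreover have "card (insert z (N w \<inter> far z)) + l = k" using card_N_Int_far[OF w] by simp
  moreover have "card (N w \<inter> N w') \<le> m"
    using lm card_N_adj[of w w'] card_N_nonadj[of w w'] w w' E_in_V2 by (cases "E w w'") auto
  ultimately show False using lm mk by linarith
qed

text \<open>The dual argument: \<open>far_class\<close> is applied to the common non-neighbours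
  \<open>X\<close> of an edge \<open>z w\<close>, at least three by \<open>cm\<close>. Their blocks
  agree, so their neighbourhoods outside \<open>N z\<close> are pairwise disjoint; yet every other
  vertex of \<open>far z\<close> turns out to be adjacent to all of \<open>X\<close>.\<close>

lemma not_dense_nonadjacent:
  assumes mk: "k < 2 * m" and cm: "2 * k + 3 \<le> card V + l"
  shows "m \<le> l"
proof (rule ccontr)
  assume "\<not> m \<le> l"
  then have lm: "l < m" by simp
  obtain z where z: "z \<in> V" using V_nonempty by auto
  have M3: "3 \<le> card (far z - N w)" if "E z w" for w
  proof -
    have "card (far z - N w) = card (far z) - card (N w \<inter> far z)"
      by (simp add: card_Diff_subset_Int Int_commute)
    moreover have "card (N w \<inter> far z) \<le> card (far z)" by (intro card_mono) auto
    ultimately show ?thesis using card_N_Int_far[OF that] card_far[OF z] cm by linarith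
  qed
  have common: "card (N y \<inter> N y' \<inter> N z) = card (N y \<inter> N y')"
    if w: "E z w" and y: "y \<in> far z - N w" "y' \<in> far z - N w" and ne: "y \<noteq> y'" for w y y'
  proof -
    have far: "y \<in> far z" "y' \<in> far z" using y by auto
    \<comment> \<open>Both blocks miss \<open>w\<close>, so they do not cover \<open>N z\<close>;
      this excludes the extreme value \<open>2 * m - k\<close>.\<close>
    have "card (N z \<inter> (N y \<union> N y')) \<le> card (N z - {w})"
      using y E_sym by (intro card_mono) auto
    also have "\<dots> < k" using card_Diff1_less[of "N z" w] w card_N[OF z] by simp
    finally have "2 * m < card (N y \<inter> N y' \<inter> N z) + k"
      using card_triple_Un[OF z far] by linarith
    moreover have "card (N y \<inter> N y') \<le> m"
      using far lm card_N_adj[of y y'] card_N_nonadj[of y y'] ne by (cases "E y y'") auto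
    ultimately show ?thesis
      using triple_cases[OF z far ne] card_triple_le_common[of y y' z] mk by linarith
  qed
  have cls: "\<not> E y y' \<and> N y \<inter> N z = N y' \<inter> N z"
    if "E z w" "y \<in> far z - N w" "y' \<in> far z - N w" "y \<noteq> y'" for w y y'
    using far_class[OF lm z _ M3[OF that(1)] common[OF that(1)], of y y'] that by blast
  obtain w0 where w0: "E z w0" using obtain_neighbour[OF z] .
  obtain y where y: "y \<in> far z" using obtain_far_neighbour[OF w0] .
  have "\<exists>w. w \<in> N z \<and> w \<notin> N y"
    using card_N_far[OF z y] card_N[OF z] m_less by (intro ex_in_Diff) (auto simp: Int_commute)
  then obtain w where w: "E z w" "\<not> E y w" by auto
  define X where "X = far z - N w"
  define Q where "Q x = N x - N z" for x
  have yX: "y \<in> X" using y w E_sym by (auto simp: X_def)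
  have cX: "3 \<le> card X" using M3[OF w(1)] by (simp add: X_def)
  have Qdisj: "Q a \<inter> Q b = {}" if "a \<in> X" "b \<in> X" "a \<noteq> b" for a b
  proof -
    have "N a \<inter> N b \<inter> N z = N a \<inter> N b"
      using common[OF w(1), of a b] that by (intro card_subset_eq) (auto simp: X_def)
    then show ?thesis by (auto simp: Q_def)
  qed
  have Qne: "Q a \<noteq> {}" if "a \<in> far z" for a
    using card_N_Diff_far[OF z that] m_less unfolding Q_def
    by (metis card.empty less_irrefl zero_less_diff)
  have Qeq: "Q a = Q b" if a: "a \<in> X" and b: "b \<in> far z - X" and nE: "\<not> E a b" for a b
  proof -
    have far: "a \<in> far z" "b \<in> far z" and ne: "a \<noteq> b" using a b by (auto simp: X_def)
    have "card (N a \<inter> N b \<inter> N z) \<noteq> m"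
    proof
      assume "card (N a \<inter> N b \<inter> N z) = m"
      then have "N a \<inter> N z = N b \<inter> N z" using triple_eq[OF z far] by simp
      moreover have "w \<in> N b \<inter> N z" "w \<notin> N a" using a b w E_sym by (auto simp: X_def)
      ultimately show False by auto
    qed
    moreover have "card (N a \<inter> N b) = m" using card_N_nonadj[of a b] far ne nE by auto
    ultimately have "card (N a \<inter> N b \<inter> N z) + k = 2 * m"
      using triple_cases[OF z far ne] card_triple_ge[OF z far] mk by linarith
    then have "card (Q a \<inter> Q b) = k - m"
      using card_common_split[of a b z] \<open>card (N a \<inter> N b) = m\<close> by (simp add: Q_def)
    then have "Q a \<inter> Q b = Q a" "Q a \<inter> Q b = Q b"
      using card_N_Diff_far[OF z] far by (intro card_subset_eq; simp add: Q_def)+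
    then show ?thesis by simp
  qed
  \<comment> \<open>A non-neighbour \<open>a\<close> of \<open>b\<close> in \<open>X\<close> has
    \<open>Q a = Q b\<close>, and by disjointness there is at most one such \<open>a\<close>. The
    two further members of \<open>X\<close> would then both be adjacent to \<open>b\<close>, against
    the disjointness of their sets \<open>Q\<close>.\<close>
  have nonadj_out: "E a b" if a: "a \<in> X" and b: "b \<in> far z - X" for a b
  proof (rule ccontr)
    assume nE: "\<not> E a b"
    have "\<exists>a1. a1 \<in> X \<and> a1 \<notin> {a}"
      using cX a by (intro ex_in_Diff) (auto simp: X_def)
    then obtain a1 where a1: "a1 \<in> X" "a1 \<noteq> a" by auto
    have "card (X \<inter> {a, a1}) \<le> card {a, a1}" by (intro card_mono) auto
    also have "\<dots> = 2" using a1 by simp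
    finally have "\<exists>a2. a2 \<in> X \<and> a2 \<notin> {a, a1}"
      using cX by (intro ex_in_Diff) (auto simp: X_def)
    then obtain a2 where a2: "a2 \<in> X" "a2 \<noteq> a" "a2 \<noteq> a1" by auto
    have adj: "E c b" if "c \<in> X" "c \<noteq> a" for c
      using Qeq[OF a b nE] Qeq[OF that(1) b] Qdisj[OF that(1) a that(2)] Qne[of a] a
      by (auto simp: X_def)
    have "b \<in> Q a1 \<inter> Q a2" using adj a1 a2 b by (auto simp: Q_def)
    then show False using Qdisj[of a1 a2] a1 a2 by auto
  qed
  obtain u where u: "u \<in> Q y" using Qne[OF y] by auto
  have "u \<in> far z" using u N_Diff_far[OF y] by (auto simp: Q_def)
  moreover have "u \<notin> X"
    using cls[OF w(1), of y u] yX u E_irrefl by (auto simp: X_def Q_def)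
  moreover have "\<exists>y1. y1 \<in> X \<and> y1 \<notin> {y}"
    using cX yX by (intro ex_in_Diff) (auto simp: X_def)
  then obtain y1 where y1: "y1 \<in> X" "y1 \<noteq> y" by auto
  ultimately have "u \<in> Q y1" using nonadj_out[of y1 u] by (auto simp: Q_def)
  then show False using Qdisj[OF yX y1(1)] y1 u by auto
qed

end

section \<open>The cases \<open>m = 2\<close> and \<open>m = 1\<close>\<close>

context primitive_srg
begin

text \<open>The Moore bound for diameter two, from \<open>parameter_equation\<close> and
  \<open>m \<ge> 1\<close>. It turns a lower bound on the order into one on the degree.\<close>

lemma card_V_le: "card V \<le> k * k + 1"
proof -
  have eq: "k * k + m * k + m = m * card V + k + l * k"
    by (rule parameter_equation[OF V_nonempty])
  show ?thesis
  proof (rule ccontr)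
    assume "\<not> ?thesis"
    then have "m * (k * k + 2) \<le> m * card V" by (intro mult_le_mono2) simp
    then have "m * (k * k) + m + k \<le> k * k + m * k" using eq by (simp add: algebra_simps)
    moreover obtain j where "m = Suc j" using m_pos by (cases m) auto
    moreover have "j * k \<le> j * (k * k)" by (cases k) auto
    ultimately show False by (simp add: algebra_simps)
  qed
qed

lemma shatters_pair: "\<exists>x\<in>V. \<exists>y\<in>V. x \<noteq> y \<and> shatters V E {x, y}"
proof -
  obtain x where x: "x \<in> V" using V_nonempty by auto
  obtain w where w: "E x w" using obtain_neighbour[OF x] .
  obtain y where y: "y \<in> far x" using obtain_far_neighbour[OF w] .
  have V: "x \<in> V" "y \<in> V" "x \<noteq> y" "\<not> E x y" "\<not> E y x" using x y E_sym by auto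
  have c: "card (N x \<inter> N y) = m" using card_N_nonadj V by simp
  have "N x \<inter> N y \<noteq> {}" using c m_pos by auto
  then obtain a where "a \<in> N x \<inter> N y" by blast
  then have a: "a \<in> V" "E a x" "E a y" using E_sym E_in_V2 by auto
  have "\<exists>u. u \<in> N x \<and> u \<notin> N y" using c card_N V m_less by (intro ex_in_Diff) auto
  then obtain b where "E x b" "\<not> E y b" by auto
  then have b: "b \<in> V" "E b x" "\<not> E b y" using E_sym E_in_V2 by blast+
  have "\<exists>u. u \<in> N y \<and> u \<notin> N x"
    using c card_N V m_less by (intro ex_in_Diff) (auto simp: Int_commute)
  then obtain d where "E y d" "\<not> E x d" by auto
  then have d: "d \<in> V" "\<not> E d x" "E d y" using E_sym E_in_V2 by blast+
  have "\<exists>u\<in>V. {s \<in> {x, y}. E u s} = A" if A: "A \<subseteq> {x, y}" for A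
  proof -
    \<comment> \<open>The patterns come from \<open>a\<close> (both), \<open>b\<close> (only
      \<open>x\<close>), \<open>d\<close> (only \<open>y\<close>) and \<open>x\<close> itself
      (none).\<close>
    have "\<exists>u\<in>V. (E u x \<longleftrightarrow> x \<in> A) \<and> (E u y \<longleftrightarrow> y \<in> A)"
      using a b d V E_irrefl[of x] by (cases "x \<in> A"; cases "y \<in> A") blast+
    then obtain u where "u \<in> V" "E u x \<longleftrightarrow> x \<in> A" "E u y \<longleftrightarrow> y \<in> A" by blast
    then have "{s \<in> {x, y}. E u s} = A" using A by blast
    then show ?thesis using \<open>u \<in> V\<close> by blast
  qed
  then show ?thesis using V unfolding shatters_def by blast
qed

text \<open>As \<open>l_bound\<close> keeps \<open>l\<close> below half of \<open>k\<close>, the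
  order grows quadratically in \<open>k\<close>. The bound leaves a vertex outside any three closed
  neighbourhoods, each of size \<open>k + 1\<close>.\<close>

lemma card_V_gt_if_m_eq_2:
  assumes m2: "m = 2" and k: "10 \<le> k"
  shows "3 * k + 3 < card V"
proof -
  have lb: "2 * l + 1 \<le> k" using l_bound m2 by simp
  have "k * k + 2 * k + 2 = 2 * card V + k + l * k"
    using parameter_equation[OF V_nonempty] m2 by simp
  moreover have "2 * (l * k) + k \<le> k * k" using mult_le_mono1[OF lb, of k] by (simp add: algebra_simps)
  moreover have "10 * k \<le> k * k" using k by (rule mult_le_mono1)
  ultimately show ?thesis using k by linarith
qed

lemma ex_nonneighbour_of_triple:
  assumes "3 * k + 3 < card V" and "x \<in> V" "y \<in> V" "z \<in> V"
  shows "\<exists>u\<in>V. (\<not> E u x \<and> u \<noteq> x) \<and> (\<not> E u y \<and> u \<noteq> y) \<and> (\<not> E u z \<and> u \<noteq> z)"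
proof -
  let ?C = "\<lambda>x. insert x (N x)"
  have c: "card (?C x) \<le> k + 1" if "x \<in> V" for x
    using card_N[OF that] by (simp add: card_insert_if)
  have "card (?C x \<union> ?C y \<union> ?C z) \<le> card (?C x) + card (?C y) + card (?C z)"
    by (meson add_right_mono card_Un_le le_trans)
  then have "card (?C x \<union> ?C y \<union> ?C z) < card V" using c[OF assms(2)] c[OF assms(3)] c[OF assms(4)] assms(1) by linarith
  then have "\<not> V \<subseteq> ?C x \<union> ?C y \<union> ?C z" using card_mono[of "?C x \<union> ?C y \<union> ?C z" V] by auto
  then obtain u where "u \<in> V" "u \<notin> ?C x \<union> ?C y \<union> ?C z" by blast
  then show ?thesis using E_sym by (intro bexI[of _ u]) auto
qed

text \<open>
  The next two lemmas are applied to the complement of the graph of interest, whose open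
  neighbourhoods are the complements of the closed neighbourhoods here.
\<close>

lemma closed_shatters_triple_no_triangle:
  assumes m2: "m = 2" and k: "10 \<le> k" and l0: "l = 0"
  obtains x y z where "x \<in> V" "y \<in> V" "z \<in> V" "x \<noteq> y" "x \<noteq> z" "y \<noteq> z"
    "shatters V (\<lambda>u s. \<not> E u s \<and> u \<noteq> s) {x, y, z}"
proof -
  note none = ex_nonneighbour_of_triple[OF card_V_gt_if_m_eq_2[OF m2 k]]
  obtain z where z: "z \<in> V" using V_nonempty by auto
  obtain w where w: "E z w" using obtain_neighbour[OF z] .
  obtain x where x: "x \<in> far z" "E w x" using obtain_far_neighbour[OF w] .
  have tri: "\<not> E a b" if "E w a" "E w b" for a b
  proof
    assume "E a b"
    then have "card (N a \<inter> N b) = 0" using card_N_adj l0 by simp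
    then have "N a \<inter> N b = {}" by simp
    moreover have "w \<in> N a \<inter> N b" using that E_sym by auto
    ultimately show False by blast
  qed
  have wV: "w \<in> V" using w E_in_V2 by auto
  have nV: "a \<in> V" if "E w a" for a using that E_in_V2 by auto
  \<comment> \<open>The second common neighbour \<open>c\<close> of \<open>a\<close> and
    \<open>b\<close>, besides \<open>w\<close>. It is not adjacent to \<open>w\<close>, as there are
    no triangles, so \<open>a\<close> and \<open>b\<close> exhaust the \<open>m = 2\<close> common
    neighbours of \<open>c\<close> and \<open>w\<close>, and \<open>d\<close> is not adjacent to
    \<open>c\<close>.\<close>
  have second: "\<exists>c\<in>V. E c a \<and> E c b \<and> \<not> E c d \<and> c \<noteq> d"
    if n: "E w a" "E w b" "E w d" and ne: "a \<noteq> b" "a \<noteq> d" "b \<noteq> d" for a b d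
  proof -
    have "card (N a \<inter> N b) = 2" using card_N_nonadj[of a b] n ne tri nV m2 by auto
    then have "card (N a \<inter> N b - {w}) \<noteq> 0"
      using n E_sym by (subst card_Diff_subset) auto
    then have "N a \<inter> N b - {w} \<noteq> {}" by (metis card.empty)
    then obtain c where "c \<in> N a \<inter> N b - {w}" by blast
    then have c: "E c a" "E c b" "c \<noteq> w" "c \<in> V" using E_sym E_in_V2 by auto
    have "\<not> E w c" using tri[of c a] c n by auto
    then have "card (N w \<inter> N c) = 2" using card_N_nonadj[of w c] c wV m2 by auto
    moreover have "card {a, b, d} \<le> card (N w \<inter> N c)" if "E c d"
      using that n c by (intro card_mono) auto
    ultimately have "\<not> E c d" using ne by auto
    moreover have "c \<noteq> d" using tri[of d a] c n by auto
    ultimately show ?thesis using c by blast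
  qed
  have wz: "E w z" using w E_sym by auto
  have "card (N w \<inter> {z, x}) \<le> card {z, x}" by (intro card_mono) auto
  also have "\<dots> \<le> 2" by (simp add: card_insert_if)
  finally have "\<exists>y. y \<in> N w \<and> y \<notin> {z, x}"
    using card_N[OF wV] k by (intro ex_in_Diff) auto
  then obtain y where y: "E w y" "y \<noteq> z" "y \<noteq> x" by auto
  have xz: "x \<noteq> z" using x by auto
  note V = nV[OF x(2)] nV[OF y(1)] z
  have nE: "\<not> E a b" if "a \<in> {x, y, z}" "b \<in> {x, y, z}" for a b
    using tri that x(2) y(1) wz by blast
  \<comment> \<open>In terms of closed neighbourhoods, \<open>none\<close> meets no vertex of the
    triple, each of \<open>x\<close>, \<open>y\<close>, \<open>z\<close> only itself, the vertices
    from \<open>second\<close> exactly two, and \<open>w\<close> all three.\<close>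
  have "shatters V (\<lambda>u s. \<not> E u s \<and> u \<noteq> s) {x, y, z}"
  proof (rule shatters_tripleI)
    show "\<exists>u\<in>V. (\<not> E u x \<and> u \<noteq> x) \<and> (\<not> E u y \<and> u \<noteq> y) \<and> \<not> E u z \<and> u \<noteq> z"
      using none[OF V] by blast
    show "\<exists>u\<in>V. (\<not> E u x \<and> u \<noteq> x) \<and> (\<not> E u y \<and> u \<noteq> y) \<and> \<not> (\<not> E u z \<and> u \<noteq> z)"
      using nE V y xz by (intro bexI[of _ z]) auto
    show "\<exists>u\<in>V. (\<not> E u x \<and> u \<noteq> x) \<and> \<not> (\<not> E u y \<and> u \<noteq> y) \<and> \<not> E u z \<and> u \<noteq> z"
      using nE V y xz by (intro bexI[of _ y]) auto
    show "\<exists>u\<in>V. \<not> (\<not> E u x \<and> u \<noteq> x) \<and> (\<not> E u y \<and> u \<noteq> y) \<and> \<not> E u z \<and> u \<noteq> z"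
      using nE V y xz by (intro bexI[of _ x]) auto
    show "\<exists>u\<in>V. (\<not> E u x \<and> u \<noteq> x) \<and> \<not> (\<not> E u y \<and> u \<noteq> y) \<and> \<not> (\<not> E u z \<and> u \<noteq> z)"
      using second[OF y(1) wz x(2)] y xz by blast
    show "\<exists>u\<in>V. \<not> (\<not> E u x \<and> u \<noteq> x) \<and> (\<not> E u y \<and> u \<noteq> y) \<and> \<not> (\<not> E u z \<and> u \<noteq> z)"
      using second[OF x(2) wz y(1)] y xz by blast
    show "\<exists>u\<in>V. \<not> (\<not> E u x \<and> u \<noteq> x) \<and> \<not> (\<not> E u y \<and> u \<noteq> y) \<and> \<not> E u z \<and> u \<noteq> z"
      using second[OF x(2) y(1) wz] y xz by blast
    show "\<exists>u\<in>V. \<not> (\<not> E u x \<and> u \<noteq> x) \<and> \<not> (\<not> E u y \<and> u \<noteq> y) \<and> \<not> (\<not> E u z \<and> u \<noteq> z)"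
      using wV x(2) y(1) wz by blast
  qed
  then show thesis using that[of x y z] V y xz by auto
qed

lemma closed_shatters_triple_triangle:
  assumes m2: "m = 2" and k: "10 \<le> k" and l1: "l \<noteq> 0"
  obtains x y z where "x \<in> V" "y \<in> V" "z \<in> V" "x \<noteq> y" "x \<noteq> z" "y \<noteq> z"
    "shatters V (\<lambda>u s. \<not> E u s \<and> u \<noteq> s) {x, y, z}"
proof -
  have lb: "2 * l + 1 \<le> k" using l_bound m2 by simp
  note none = ex_nonneighbour_of_triple[OF card_V_gt_if_m_eq_2[OF m2 k]]
  obtain z where z: "z \<in> V" using V_nonempty by auto
  obtain w where w: "E z w" using obtain_neighbour[OF z] .
  obtain x where x: "x \<in> far z" "E w x" using obtain_far_neighbour[OF w] .
  have cxz: "card (N x \<inter> N z) = 2" using card_N_far[OF z x(1)] m2 by simp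
  then have "card (N x \<inter> N z - {w}) = 1"
    using w x E_sym by (subst card_Diff_subset) auto
  then obtain w' where "N x \<inter> N z - {w} = {w'}" by (auto simp: card_1_singleton_iff)
  then have xz: "N x \<inter> N z = {w, w'}" "w' \<noteq> w" using w x E_sym by auto
  have w': "E x w'" "E z w'" using xz by auto
  have V: "x \<in> V" "z \<in> V" "w \<in> V" "w' \<in> V" and xz': "x \<noteq> z" "\<not> E z x" "\<not> E x z"
    using z x w w' E_sym E_in_V2 by auto
  \<comment> \<open>Otherwise every common neighbour of \<open>x\<close> and \<open>w\<close> other
    than \<open>w'\<close> is adjacent to \<open>w'\<close>. Then \<open>w\<close> and
    \<open>w'\<close> have too many common neighbours: \<open>l + 1\<close> if they are adjacent,
    and three, including \<open>x\<close> and \<open>z\<close>, if they are not.\<close>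
  have "\<exists>y. E x y \<and> E w y \<and> y \<noteq> w' \<and> \<not> E y w'"
  proof (rule ccontr)
    assume "\<not> ?thesis"
    then have *: "E w' y" if "E x y" "E w y" "y \<noteq> w'" for y using that E_sym by blast
    have cxw: "card (N x \<inter> N w) = l" using card_N_adj x E_sym by blast
    show False
    proof (cases "E w w'")
      case True
      have "N x \<inter> N w - {w'} \<subseteq> N w \<inter> N w'"
      proof
        fix u assume "u \<in> N x \<inter> N w - {w'}"
        then show "u \<in> N w \<inter> N w'" using *[of u] by simp
      qed
      then have "insert z (insert x (N x \<inter> N w - {w'})) \<subseteq> N w \<inter> N w'"
        using w w' x E_sym by auto
      then have "card (insert z (insert x (N x \<inter> N w - {w'}))) \<le> l"
        using card_N_adj[OF True] by (metis card_mono finite_Int finite_N)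
      moreover have "card (insert z (insert x (N x \<inter> N w - {w'}))) = card (N x \<inter> N w - {w'}) + 2"
        using xz' E_irrefl by simp
      moreover have "card (N x \<inter> N w - {w'}) = l - 1"
        using True w' cxw by (subst card_Diff_subset) auto
      ultimately show False by simp
    next
      case False
      have "N x \<inter> N w \<noteq> {}" using cxw l1 by auto
      then obtain y where "y \<in> N x \<inter> N w" by blast
      then have y: "E x y" "E w y" "E w' y" using *[of y] False by auto
      have "card (N w \<inter> N w') = 2" using card_N_nonadj[of w w'] V xz(2) False m2 by auto
      moreover have "card {z, x, y} \<le> card (N w \<inter> N w')"
        using y w w' x E_sym by (intro card_mono) auto
      moreover have "y \<noteq> z" "y \<noteq> x" using y xz' E_irrefl by auto
      ultimately show False using xz' by auto
    qed
  qed
  then obtain y where y: "E x y" "E w y" "y \<noteq> w'" "\<not> E y w'" by blast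
  have ww: "y \<noteq> w" using y E_irrefl by auto
  have yz: "y \<noteq> z" using y xz' by auto
  have nyz: "\<not> E y z"
  proof
    assume "E y z"
    then have "y \<in> N x \<inter> N z" using y E_sym by auto
    then show False using xz y ww by auto
  qed
  then have nzy: "\<not> E z y" using E_sym by blast
  have yV: "y \<in> V" using y E_in_V2 by auto
  have xy: "x \<noteq> y" using y E_irrefl by auto
  have "card (N y \<inter> N z) = 2" using card_N_nonadj[of y z] yV V yz nyz m2 by simp
  then have "card (N y \<inter> N z - {w}) = 1"
    using w y E_sym by (subst card_Diff_subset) auto
  then obtain v where "N y \<inter> N z - {w} = {v}" by (auto simp: card_1_singleton_iff)
  then have "v \<in> N y \<inter> N z - {w}" by blast
  then have v: "E y v" "E z v" "v \<noteq> w" by auto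
  \<comment> \<open>The common neighbours of \<open>x\<close> and \<open>z\<close> are
    \<open>w\<close> and \<open>w'\<close>; \<open>v\<close> differs from \<open>w\<close> by
    choice, and from \<open>w'\<close> because \<open>y\<close> is not adjacent to
    \<open>w'\<close>.\<close>
  have xv: "\<not> E x v"
  proof
    assume "E x v"
    then have "v \<in> N x \<inter> N z" using v by auto
    then have "v = w'" using xz(1) v(3) by blast
    then show False using v y by simp
  qed
  have vV: "v \<in> V" "E v y" "E v z" "\<not> E v x" using v xv E_sym E_in_V2 by blast+
  have vx: "v \<noteq> x" using v xz' by auto
  \<comment> \<open>At most \<open>l + 1\<close> vertices of \<open>N a\<close> lie in the closed
    neighbourhood of \<open>b\<close> and two in \<open>N z\<close>, together fewer than
    \<open>k\<close>.\<close>
  have single: "\<exists>u\<in>V. E u a \<and> \<not> E u b \<and> u \<noteq> b \<and> \<not> E u z \<and> u \<noteq> z"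
    if "a \<in> V" "E a b" "card (N a \<inter> N z) = 2" "a \<noteq> z" "\<not> E a z" for a b
  proof -
    have "card (N a \<inter> (insert b (N b) \<union> N z)) \<le> card (N a \<inter> insert b (N b)) + card (N a \<inter> N z)"
      by (metis Int_Un_distrib card_Un_le)
    also have "card (N a \<inter> insert b (N b)) \<le> card (N a \<inter> N b) + 1"
      using that by (simp add: card_insert_if)
    finally have "\<exists>u. u \<in> N a \<and> u \<notin> insert b (N b) \<union> N z"
      using that card_N_adj[of a b] card_N[of a] lb k by (intro ex_in_Diff) auto
    then obtain u where "E a u" "u \<noteq> b" "\<not> E b u" "\<not> E z u" by auto
    then show ?thesis using that E_sym E_in_V2 by (intro bexI[of _ u]) auto
  qed
  have sx: "\<exists>u\<in>V. E u x \<and> \<not> E u y \<and> u \<noteq> y \<and> \<not> E u z \<and> u \<noteq> z"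
    using single[of x y] V y cxz xz' by blast
  have sy: "\<exists>u\<in>V. E u y \<and> \<not> E u x \<and> u \<noteq> x \<and> \<not> E u z \<and> u \<noteq> z"
    using single[of y x] yV y E_sym \<open>card (N y \<inter> N z) = 2\<close> yz nyz by blast
  have "shatters V (\<lambda>u s. \<not> E u s \<and> u \<noteq> s) {x, y, z}"
  proof (rule shatters_tripleI)
    show "\<exists>u\<in>V. (\<not> E u x \<and> u \<noteq> x) \<and> (\<not> E u y \<and> u \<noteq> y) \<and> \<not> E u z \<and> u \<noteq> z"
      using none[of x y z] V yV by blast
    show "\<exists>u\<in>V. (\<not> E u x \<and> u \<noteq> x) \<and> (\<not> E u y \<and> u \<noteq> y) \<and> \<not> (\<not> E u z \<and> u \<noteq> z)"
      using V xz' yz nzy by (intro bexI[of _ z]) auto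
    show "\<exists>u\<in>V. (\<not> E u x \<and> u \<noteq> x) \<and> \<not> (\<not> E u y \<and> u \<noteq> y) \<and> \<not> E u z \<and> u \<noteq> z"
      using sy by blast
    show "\<exists>u\<in>V. \<not> (\<not> E u x \<and> u \<noteq> x) \<and> (\<not> E u y \<and> u \<noteq> y) \<and> \<not> E u z \<and> u \<noteq> z"
      using sx by blast
    show "\<exists>u\<in>V. (\<not> E u x \<and> u \<noteq> x) \<and> \<not> (\<not> E u y \<and> u \<noteq> y) \<and> \<not> (\<not> E u z \<and> u \<noteq> z)"
      using vV vx by blast
    show "\<exists>u\<in>V. \<not> (\<not> E u x \<and> u \<noteq> x) \<and> (\<not> E u y \<and> u \<noteq> y) \<and> \<not> (\<not> E u z \<and> u \<noteq> z)"
      using V w' y E_sym by (intro bexI[of _ w']) auto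
    show "\<exists>u\<in>V. \<not> (\<not> E u x \<and> u \<noteq> x) \<and> \<not> (\<not> E u y \<and> u \<noteq> y) \<and> \<not> E u z \<and> u \<noteq> z"
      using V y xz' E_irrefl by (intro bexI[of _ x]) auto
    show "\<exists>u\<in>V. \<not> (\<not> E u x \<and> u \<noteq> x) \<and> \<not> (\<not> E u y \<and> u \<noteq> y) \<and> \<not> (\<not> E u z \<and> u \<noteq> z)"
      using V w x y E_sym by (intro bexI[of _ w]) auto
  qed
  then show thesis using that[of x y z] V yV xz' yz xy by auto
qed

text \<open>Excludes, for \<open>m = 1\<close>, large Moore graphs (\<open>l = 0\<close>) and friendship graphs (\<open>l = 1\<close>).\<close>

lemma l_ge_2_if_m_eq_1:
  assumes m1: "m = 1" and k: "58 \<le> k"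
  shows "2 \<le> l"
proof (rule ccontr)
  assume "\<not> 2 \<le> l"
  then consider "l = 0" | "l = 1" by linarith
  then show False
  proof cases
    case 1
    have v: "card V = k * k + 1"
      using parameter_equation[OF V_nonempty] m1 1 by simp
    obtain c :: int where
      "(2 * int k + (int (card V) - 1) * (int l - int m))\<^sup>2 = c\<^sup>2 * ((int l - int m)\<^sup>2 + 4 * (int k - int m))"
      using rationality_condition[OF m_pos V_nonempty] .
    then have eq: "(2 * int k - int k * int k)\<^sup>2 = c\<^sup>2 * (4 * int k - 3)"
      using m1 1 v by simp
    \<comment> \<open>Dividing by \<open>c\<close> produces an integer \<open>q\<close> with square
      \<open>4 k - 3\<close>.\<close>
    then have "c\<^sup>2 dvd (2 * int k - int k * int k)\<^sup>2" by simp
    then have "c dvd 2 * int k - int k * int k" by simp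
    then obtain q where q: "2 * int k - int k * int k = c * q" by (auto elim: dvdE)
    have "int k * (2 - int k) \<noteq> 0" using k by simp
    then have c0: "c \<noteq> 0" using q by (auto simp: algebra_simps)
    have "c\<^sup>2 * q\<^sup>2 = c\<^sup>2 * (4 * int k - 3)" using eq unfolding q by (simp add: power_mult_distrib)
    then have q2: "q\<^sup>2 = 4 * int k - 3" using c0 by simp
    \<comment> \<open>Substituting \<open>4 k = q\<^sup>2 + 3\<close> into
      \<open>16 (2 k - k\<^sup>2) = 16 c q\<close> leaves the constant \<open>15\<close>, so
      \<open>q\<close> divides \<open>15\<close> and \<open>4 k - 3 \<le> 225\<close>.\<close>
    have "15 = 16 * (c * q) + q * q\<^sup>2 * q - 2 * q * q"
    proof -
      have "16 * (c * q) = 8 * (4 * int k) - (4 * int k) * (4 * int k)"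
        unfolding q[symmetric] by (simp add: algebra_simps)
      also have "4 * int k = q\<^sup>2 + 3" using q2 by simp
      finally show ?thesis by (simp add: algebra_simps power2_eq_square)
    qed
    then have "15 = q * (16 * c + q\<^sup>2 * q - 2 * q)" by (simp add: algebra_simps)
    then have "q dvd 15" by (rule dvdI)
    then have "\<bar>q\<bar> \<le> 15" using zdvd_imp_le[of "\<bar>q\<bar>" 15] by simp
    then have "q\<^sup>2 \<le> 15\<^sup>2" by (metis abs_le_square_iff abs_numeral)
    then show False using q2 k by simp
  next
    case 2
    obtain c :: int where
      "(2 * int k + (int (card V) - 1) * (int l - int m))\<^sup>2 = c\<^sup>2 * ((int l - int m)\<^sup>2 + 4 * (int k - int m))"
      using rationality_condition[OF m_pos V_nonempty] .
    then have "4 * (int k * int k) = 4 * (c\<^sup>2 * (int k - 1))"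
      using m1 2 by (simp add: power2_eq_square algebra_simps)
    then have "int k * int k = c\<^sup>2 * (int k - 1)" by simp
    \<comment> \<open>Since \<open>k\<^sup>2 = (k - 1) (k + 1) + 1\<close>, the divisor
      \<open>k - 1\<close> of \<open>k\<^sup>2\<close> divides \<open>1\<close>.\<close>
    then have "1 = (int k - 1) * (c\<^sup>2 - int k - 1)" by (simp add: algebra_simps)
    then have "int k - 1 dvd 1" by (rule dvdI)
    then have "int k - 1 \<le> 1" by (rule zdvd_imp_le) simp
    then show False using k by simp
  qed
qed

end

text \<open>Two of the \<open>l \<ge> 2\<close> common neighbours of an edge are adjacent, as
  otherwise they would share both of its ends. In the resulting clique the fourth vertex sees the
  whole triangle and each corner sees the other two; \<open>2 l + 2 \<le> k\<close> gives the
  singletons and \<open>3 k < v\<close> the empty pattern.\<close>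

lemma (in no_shattered_triple) m_neq_1:
  assumes k: "58 \<le> k"
  shows "m \<noteq> 1"
proof
  assume m1: "m = 1"
  have l2: "2 \<le> l" using l_ge_2_if_m_eq_1[OF m1 k] .
  have lb: "2 * l + 2 \<le> k" using l_bound m1 by simp
  have big: "3 * k < card V"
  proof -
    have "k * k + k + 1 = card V + k + l * k"
      using parameter_equation[OF V_nonempty] m1 by simp
    moreover have "2 * (l * k) + 2 * k \<le> k * k"
      using mult_le_mono1[OF lb, of k] by (simp add: algebra_simps)
    moreover have "58 * k \<le> k * k" using k by (rule mult_le_mono1)
    ultimately show ?thesis by linarith
  qed
  obtain x where x: "x \<in> V" using V_nonempty by auto
  obtain y where y: "E x y" using obtain_neighbour[OF x] .
  have yV: "y \<in> V" using y E_in_V2 by auto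
  obtain S where "S \<subseteq> N x \<inter> N y" "card S = 2"
    using card_N_adj[OF y] l2 by (metis obtain_subset_with_card_n)
  then obtain z u where zu: "z \<in> N x \<inter> N y" "u \<in> N x \<inter> N y" "z \<noteq> u"
    by (auto simp: card_2_iff)
  then have z: "E x z" "E y z" "z \<in> V" and u: "E x u" "E y u" "u \<in> V" using E_in_V2 by auto
  have "E z u"
  proof (rule ccontr)
    assume "\<not> E z u"
    then have "card (N z \<inter> N u) = 1" using card_N_nonadj[OF z(3) u(3)] zu m1 by simp
    moreover have "card {x, y} \<le> card (N z \<inter> N u)"
      using z u E_sym by (intro card_mono) auto
    moreover have "x \<noteq> y" using y E_irrefl by auto
    ultimately show False by simp
  qed
  have one: "\<exists>v\<in>V. E v a \<and> \<not> E v b \<and> \<not> E v c" if "E a b" "E a c" for a b c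
  proof -
    have "\<exists>v. v \<in> N a \<and> v \<notin> N b \<union> N c"
      using card_Int_Un[of "N a" "N b" "N c"] card_N_adj[OF that(1)] card_N_adj[OF that(2)]
        card_N[of a] E_in_V[OF that(1)] lb
      by (intro ex_in_Diff) auto
    then obtain v where "E a v" "\<not> E b v" "\<not> E c v" by auto
    then show ?thesis using E_sym E_in_V2 by (intro bexI[of _ v]) auto
  qed
  have "card (N x \<union> N y \<union> N z) \<le> card (N x) + card (N y) + card (N z)"
    by (meson add_right_mono card_Un_le le_trans)
  then have "card (N x \<union> N y \<union> N z) < card V" using card_N x yV z(3) big by simp
  then have "\<not> V \<subseteq> N x \<union> N y \<union> N z" using card_mono[of "N x \<union> N y \<union> N z" V] by auto
  then obtain v where "v \<in> V" "v \<notin> N x \<union> N y \<union> N z" by blast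
  then have v: "v \<in> V" "\<not> E v x" "\<not> E v y" "\<not> E v z" using E_sym by auto
  note sym = E_sym[OF y] E_sym[OF z(1)] E_sym[OF z(2)]
  have "shatters V E {x, y, z}"
  proof (rule shatters_tripleI)
    show "\<exists>u\<in>V. E u x \<and> E u y \<and> E u z"
      using u \<open>E z u\<close> E_sym by (intro bexI[of _ u]) auto
    show "\<exists>u\<in>V. E u x \<and> E u y \<and> \<not> E u z"
      using z sym E_irrefl by (intro bexI[of _ z]) auto
    show "\<exists>u\<in>V. E u x \<and> \<not> E u y \<and> E u z"
      using yV z sym E_irrefl by (intro bexI[of _ y]) auto
    show "\<exists>u\<in>V. \<not> E u x \<and> E u y \<and> E u z"
      using x y z E_irrefl by (intro bexI[of _ x]) auto
    show "\<exists>u\<in>V. E u x \<and> \<not> E u y \<and> \<not> E u z" using one[OF y z(1)] .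
    show "\<exists>u\<in>V. \<not> E u x \<and> E u y \<and> \<not> E u z" using one[OF sym(1) z(2)] by blast
    show "\<exists>u\<in>V. \<not> E u x \<and> \<not> E u y \<and> E u z" using one[OF sym(2,3)] by blast
    show "\<exists>u\<in>V. \<not> E u x \<and> \<not> E u y \<and> \<not> E u z" using v by blast
  qed
  moreover have "x \<noteq> y" "x \<noteq> z" "y \<noteq> z" using y z E_irrefl by auto
  ultimately show False using no_triple x yV z(3) by blast
qed

text \<open>For \<open>2 * m \<le> k\<close> and for \<open>k < 2 * m\<close> the preceding lemmas
  demand both \<open>l < m\<close> and \<open>m \<le> l\<close>. The boundary
  \<open>k = 2 * m\<close> takes \<open>l < m\<close> from
  \<open>not_dense_adjacent\<close>.\<close>

lemma (in no_shattered_triple) few_common_nonneighbours: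
  assumes k: "58 \<le> k"
  shows "card V + l < 2 * k + 3"
proof (rule ccontr)
  assume cm: "\<not> ?thesis"
  have m: "2 \<le> m" using m_pos m_neq_1[OF k] by linarith
  show False
  proof (cases "2 * m \<le> k")
    case True
    then have "m \<le> l" using not_sparse_nonadjacent m k by simp
    then show False
      using not_sparse_adjacent[OF m] not_dense_adjacent True by fastforce
  next
    case False
    then show False
      using not_dense_nonadjacent not_dense_adjacent cm by fastforce
  qed
qed

section \<open>VC-dimension two\<close>

context srg
begin

section \<open>The complement, connectedness, and unique common non-neighbours\<close>

lemma card_N_Un:
  assumes "x \<in> V" "y \<in> V"
  shows "card (N x \<union> N y) + card (N x \<inter> N y) = 2 * k"
  using card_Un_Int[of "N x" "N y"] assms card_N by simp

text \<open>Neighbourhoods in the complement are complements of closed neighbourhoods. Each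
  truncated subtraction is exact as soon as a vertex or pair of the kind it concerns exists;
  otherwise the locale asks nothing of that parameter.\<close>

lemma complement_srg:
  "srg V (\<lambda>x y. x \<in> V \<and> y \<in> V \<and> x \<noteq> y \<and> \<not> E x y)
    (card V - k - 1) (card V + m - 2 * k - 2) (card V + l - 2 * k)"
proof
  fix x assume x: "x \<in> V"
  have "{y. x \<in> V \<and> y \<in> V \<and> x \<noteq> y \<and> \<not> E x y} = far x" using x by auto
  then show "card {y. x \<in> V \<and> y \<in> V \<and> x \<noteq> y \<and> \<not> E x y} = card V - k - 1"
    using card_far[OF x] by simp
next
  fix x y assume xy: "x \<in> V \<and> y \<in> V \<and> x \<noteq> y \<and> \<not> E x y"
  then have V: "x \<in> V" "y \<in> V" by auto
  have "{u. x \<in> V \<and> u \<in> V \<and> x \<noteq> u \<and> \<not> E x u} \<inter> {u. y \<in> V \<and> u \<in> V \<and> y \<noteq> u \<and> \<not> E y u}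
      = V - insert x (insert y (N x \<union> N y))"
    using xy by auto
  moreover have "insert x (insert y (N x \<union> N y)) \<subseteq> V" using V N_subset by auto
  moreover have "x \<notin> insert y (N x \<union> N y)" "y \<notin> N x \<union> N y" using xy E_irrefl E_sym by auto
  then have "card (insert x (insert y (N x \<union> N y))) = card (N x \<union> N y) + 2" by simp
  moreover have "card (N x \<union> N y) + m = 2 * k" using card_N_Un[OF V] card_N_nonadj xy by auto
  ultimately show "card ({u. x \<in> V \<and> u \<in> V \<and> x \<noteq> u \<and> \<not> E x u} \<inter>
      {u. y \<in> V \<and> u \<in> V \<and> y \<noteq> u \<and> \<not> E y u}) = card V + m - 2 * k - 2"
    by (simp add: card_Diff_subset)
next
  fix x y assume V: "x \<in> V" "y \<in> V" "x \<noteq> y" and "\<not> (x \<in> V \<and> y \<in> V \<and> x \<noteq> y \<and> \<not> E x y)"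
  then have E: "E x y" by auto
  have "{u. x \<in> V \<and> u \<in> V \<and> x \<noteq> u \<and> \<not> E x u} \<inter> {u. y \<in> V \<and> u \<in> V \<and> y \<noteq> u \<and> \<not> E y u}
      = V - (N x \<union> N y)"
    using V E E_sym by auto
  moreover have "N x \<union> N y \<subseteq> V" using N_subset by auto
  moreover have "card (N x \<union> N y) + l = 2 * k" using card_N_Un[OF V(1,2)] card_N_adj[OF E] by simp
  ultimately show "card ({u. x \<in> V \<and> u \<in> V \<and> x \<noteq> u \<and> \<not> E x u} \<inter>
      {u. y \<in> V \<and> u \<in> V \<and> y \<noteq> u \<and> \<not> E y u}) = card V + l - 2 * k"
    by (simp add: card_Diff_subset)
qed (use finite_V E_sym in auto)

text \<open>The closed neighbourhood of \<open>x\<close> is not all of \<open>V\<close>, so some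
  edge \<open>u w\<close> leaves it. Then \<open>u\<close> is a common neighbour of the non-adjacent
  \<open>x\<close> and \<open>w\<close>, and \<open>N u\<close> contains \<open>x\<close>,
  \<open>w\<close> and the \<open>l\<close> common neighbours of \<open>x\<close> and
  \<open>u\<close>.\<close>

lemma connected_parameters:
  assumes conn: "\<forall>S. \<forall>x\<in>V \<inter> S. (\<forall>u\<in>S. \<forall>w. E u w \<longrightarrow> w \<in> S) \<longrightarrow> V \<subseteq> S"
    and xy: "x \<in> V" "y \<in> V" "x \<noteq> y" "\<not> E x y"
  shows "0 < m" and "l + 1 < k"
proof -
  have "\<not> V \<subseteq> insert x (N x)" using xy by auto
  then obtain u w where "u \<in> insert x (N x)" "E u w" "w \<notin> insert x (N x)"
    using conn xy(1) by blast
  then have u: "E x u" "E u w" "w \<noteq> x" "\<not> E x w" by auto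
  then have V: "u \<in> V" "w \<in> V" using E_in_V2 by auto
  have "u \<in> N x \<inter> N w" using u E_sym by auto
  then have "card (N x \<inter> N w) \<noteq> 0" by (metis card_0_eq empty_iff finite_Int finite_N)
  then show "0 < m" using card_N_nonadj[OF xy(1) V(2)] u by auto
  have "card (insert x (insert w (N x \<inter> N u))) \<le> card (N u)"
    using u E_sym by (intro card_mono) auto
  moreover have "card (insert x (insert w (N x \<inter> N u))) = l + 2"
    using u E_irrefl card_N_adj[OF u(1)] by simp
  ultimately show "l + 1 < k" using card_N[OF V(1)] by simp
qed

text \<open>The union of \<open>N a\<close> and \<open>N b\<close> has \<open>2 k - l\<close>
  elements, one fewer than \<open>V\<close>.\<close>

lemma common_nonneighbour_unique:
  assumes v: "card V + l = 2 * k + 1" and E: "E a b"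
    and x: "x \<in> V" "\<not> E x a" "\<not> E x b" and y: "y \<in> V" "\<not> E y a" "\<not> E y b"
  shows "x = y"
proof (rule ccontr)
  assume "x \<noteq> y"
  have V: "a \<in> V" "b \<in> V" using E E_in_V E_in_V2 by auto
  have sub: "N a \<union> N b \<subseteq> V" using N_subset by auto
  have "{x, y} \<subseteq> V - (N a \<union> N b)" using x y E_sym by auto
  then have "card {x, y} \<le> card (V - (N a \<union> N b))" using finite_V by (intro card_mono) auto
  also have "\<dots> = card V - card (N a \<union> N b)" using sub by (intro card_Diff_subset) auto
  also have "\<dots> \<le> 1" using card_N_Un[OF V] card_N_adj[OF E] v by simp
  finally show False using \<open>x \<noteq> y\<close> by simp
qed

lemma no_shattered_triple_if_unique:
  assumes v: "card V + l = 2 * k + 1"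
    and V: "x \<in> V" "y \<in> V" "z \<in> V" and ne: "x \<noteq> y" "x \<noteq> z" "y \<noteq> z"
  shows "\<not> shatters V E {x, y, z}"
proof
  assume sh: "shatters V E {x, y, z}"
  have pat: "\<exists>u\<in>V. \<forall>s\<in>{x, y, z}. E u s \<longleftrightarrow> s \<in> A" if A: "A \<subseteq> {x, y, z}" for A
  proof -
    obtain u where "u \<in> V" "{s \<in> {x, y, z}. E u s} = A" using sh A unfolding shatters_def by blast
    then show ?thesis by (intro bexI[of _ u]) blast+
  qed
  have indep: "\<not> E a b" if abc: "{a, b, c} = {x, y, z}" "c \<noteq> a" "c \<noteq> b" for a b c
  proof
    assume E: "E a b"
    obtain u where u: "u \<in> V" "\<forall>s\<in>{x, y, z}. E u s \<longleftrightarrow> s \<in> {}" using pat[of "{}"] by blast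
    obtain w where w: "w \<in> V" "\<forall>s\<in>{x, y, z}. E w s \<longleftrightarrow> s \<in> {c}"
      using pat[of "{c}"] abc(1) by blast
    have "u = w"
      using common_nonneighbour_unique[OF v E] u w abc by (metis empty_iff insertI1 insert_commute singletonD)
    moreover have "E w c" "\<not> E u c" using u w abc(1) by blast+
    ultimately show False by simp
  qed
  have nE: "\<not> E x y" "\<not> E x z" "\<not> E y z"
    using indep[of x y z] indep[of x z y] indep[of y z x] ne by auto
  obtain u where u: "u \<in> V" "\<forall>s\<in>{x, y, z}. E u s \<longleftrightarrow> s \<in> {x}" using pat[of "{x}"] by blast
  then have "E u x" "\<not> E u y" "\<not> E u z" using ne by auto
  then have "y = z"
    using common_nonneighbour_unique[OF v, of u x y z] V nE E_sym by blast
  then show False using ne by simp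
qed

end

section \<open>Translation between the digraph definitions and the locale\<close>

lemma connected_closed_subset:
  assumes conn: "connected (with_proj G)"
    and sym: "\<And>u w. (u, w) \<in> parcs G \<Longrightarrow> (w, u) \<in> parcs G"
  shows "\<forall>S. \<forall>x\<in>pverts G \<inter> S. (\<forall>u\<in>S. \<forall>w. (u, w) \<in> parcs G \<longrightarrow> w \<in> S) \<longrightarrow> pverts G \<subseteq> S"
proof (intro allI ballI impI subsetI)
  fix S x w
  assume x: "x \<in> pverts G \<inter> S" and closed: "\<forall>u\<in>S. \<forall>w. (u, w) \<in> parcs G \<longrightarrow> w \<in> S"
    and "w \<in> pverts G"
  \<comment> \<open>Connectedness is reachability in the symmetric closure, whose arcs are those of
    \<open>G\<close> by \<open>sym\<close>.\<close>
  then have "(x, w) \<in> (parcs (mk_symmetric (with_proj G)))\<^sup>*"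
    using conn reachable_rtranclI[of "with_proj (mk_symmetric (with_proj G))" x w]
    by (auto simp: connected_def strongly_connected_def)
  then show "w \<in> S"
  proof (induction rule: rtrancl_induct)
    case base
    then show ?case using x by simp
  next
    case (step u w)
    then have "(u, w) \<in> parcs G" using sym by (auto simp: parcs_mk_symmetric)
    then show ?case using closed step by blast
  qed
qed

lemma strongly_regular_srg:
  assumes "strongly_regular G v k l m"
  shows "srg (pverts G) (\<lambda>x y. (x, y) \<in> parcs G) k l m"
proof -
  from assms interpret pair_graph G by (simp add: strongly_regular_def)
  show ?thesis
  proof
    show "(x, y) \<in> parcs G \<Longrightarrow> (y, x) \<in> parcs G" for x y using arcs_symmetric by blast
    show "(x, y) \<in> parcs G \<Longrightarrow> x \<in> pverts G" for x y using in_arcsD1 by blast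
    show "(x, x) \<notin> parcs G" for x using no_loops' by blast
    show "finite (pverts G)" by (rule pair_finite_verts)
    show "(x, y) \<in> parcs G \<Longrightarrow> card ({u. (x, u) \<in> parcs G} \<inter> {u. (y, u) \<in> parcs G}) = l" for x y
      using assms in_arcsD1 in_arcsD2 unfolding strongly_regular_def nbrs_def by blast
  qed (use assms in \<open>auto simp: strongly_regular_def nbrs_def\<close>)
qed

lemma shattered_iff:
  "shattered G S \<longleftrightarrow> S \<subseteq> pverts G \<and> shatters (pverts G) (\<lambda>x y. (x, y) \<in> parcs G) S"
proof -
  have "nbrs G u \<inter> S = {s \<in> S. (u, s) \<in> parcs G}" for u by (auto simp: nbrs_def)
  then show ?thesis by (simp add: shattered_def shatters_def)
qed

lemma shattered_mono:
  assumes S: "shattered G S" and T: "T \<subseteq> S"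
  shows "shattered G T"
  unfolding shattered_def
proof (intro conjI allI impI)
  show "T \<subseteq> pverts G" using S T by (auto simp: shattered_def)
  fix A assume A: "A \<subseteq> T"
  then obtain u where "u \<in> pverts G" "nbrs G u \<inter> S = A"
    using S T unfolding shattered_def by (metis order_trans)
  then show "\<exists>u\<in>pverts G. nbrs G u \<inter> T = A" using A T by blast
qed

text \<open>Shattering passes to subsets, so any shattered set with more than two elements contains
  one with exactly three.\<close>

lemma vc_dim_eq_2_iff:
  assumes fin: "finite (pverts G)" and pair: "shattered G P" "card P = 2"
  shows "vc_dim G = 2 \<longleftrightarrow> (\<forall>S. shattered G S \<longrightarrow> card S \<noteq> 3)"
proof -
  have F: "finite (card ` {S. shattered G S})"
  proof -
    have "{S. shattered G S} \<subseteq> Pow (pverts G)" by (auto simp: shattered_def)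
    then show ?thesis using fin by (meson finite_Pow_iff finite_imageI finite_subset)
  qed
  show ?thesis
  proof
    assume vc: "vc_dim G = 2"
    show "\<forall>S. shattered G S \<longrightarrow> card S \<noteq> 3"
    proof (intro allI impI)
      fix S assume "shattered G S"
      then have "card S \<le> vc_dim G" using F unfolding vc_dim_def by (intro Max_ge) auto
      then show "card S \<noteq> 3" using vc by simp
    qed
  next
    assume no3: "\<forall>S. shattered G S \<longrightarrow> card S \<noteq> 3"
    have le: "card S \<le> 2" if S: "shattered G S" for S
    proof (rule ccontr)
      assume "\<not> card S \<le> 2"
      then obtain T where "T \<subseteq> S" "card T = 3"
        using obtain_subset_with_card_n[of 3 S] by (metis Suc_leI not_le numeral_3_eq_3 numeral_2_eq_2)
      then show False using no3 shattered_mono[OF S] by blast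
    qed
    show "vc_dim G = 2" unfolding vc_dim_def
    proof (rule Max_eqI[OF F])
      show "c \<le> 2" if "c \<in> card ` {S. shattered G S}" for c using that le by auto
      show "2 \<in> card ` {S. shattered G S}" using pair by (metis (mono_tags) imageI mem_Collect_eq)
    qed
  qed
qed

theorem theorem30:
  fixes G :: "'a pair_pre_digraph" and v k l m :: nat
  assumes "strongly_regular G v k l m"
    and "primitive_graph G"
    and "v \<ge> 6401"
  shows "vc_dim G = 2 \<longleftrightarrow> compl_mu v k l = 1"
proof -
  define V where "V = pverts G"
  define E where "E = (\<lambda>x y. (x, y) \<in> parcs G)"
  define E' where "E' = (\<lambda>x y. x \<in> V \<and> y \<in> V \<and> x \<noteq> y \<and> \<not> E x y)"
  define k' l' m' where "k' = card V - k - 1" and "l' = card V + m - 2 * k - 2"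
    and "m' = card V + l - 2 * k"
  have v: "card V = v" using assms(1) by (simp add: V_def strongly_regular_def)
  interpret G: srg V E k l m
    unfolding V_def E_def by (rule strongly_regular_srg[OF assms(1)])
  interpret H: srg V E' k' l' m'
    unfolding E'_def k'_def l'_def m'_def by (rule G.complement_srg)
  have connG: "\<forall>S. \<forall>x\<in>V \<inter> S. (\<forall>u\<in>S. \<forall>w. E u w \<longrightarrow> w \<in> S) \<longrightarrow> V \<subseteq> S"
    using connected_closed_subset[of G] assms(2) G.E_sym
    unfolding primitive_graph_def V_def E_def by simp
  have connH: "\<forall>S. \<forall>x\<in>V \<inter> S. (\<forall>u\<in>S. \<forall>w. E' u w \<longrightarrow> w \<in> S) \<longrightarrow> V \<subseteq> S"
  proof -
    have eq: "pverts (compl_graph G) = V" "\<And>a b. (a, b) \<in> parcs (compl_graph G) \<longleftrightarrow> E' a b"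
      by (auto simp: compl_graph_def V_def E'_def E_def)
    have "connected (with_proj (compl_graph G))" using assms(2) by (simp add: primitive_graph_def)
    then show ?thesis
      using connected_closed_subset[of "compl_graph G"] H.E_sym unfolding eq by simp
  qed
  obtain x0 where x0: "x0 \<in> V" using v assms(3) by (cases "V = {}") auto
  \<comment> \<open>Connectedness forbids \<open>{x0}\<close> to be closed under adjacency, so the
    graph and its complement each have an edge.\<close>
  have "\<not> V \<subseteq> {x0}" using card_mono[of "{x0}" V] v assms(3) by auto
  then obtain a b where a: "E a b" using connG[THEN spec, of "{x0}"] x0 by auto
  from \<open>\<not> V \<subseteq> {x0}\<close> obtain c d where c: "E' c d" using connH[THEN spec, of "{x0}"] x0 by auto
  have cV: "c \<in> V" "d \<in> V" "c \<noteq> d" "\<not> E c d" using c by (auto simp: E'_def)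
  have aV: "a \<in> V" "b \<in> V" "a \<noteq> b" "\<not> E' a b"
    using a G.E_in_V G.E_in_V2 G.E_irrefl by (auto simp: E'_def)
  note pG = G.connected_parameters[OF connG cV] and pH = H.connected_parameters[OF connH aV]
  have k1: "k + 1 \<le> card V" using G.card_far[OF x0] by linarith
  \<comment> \<open>The union of two adjacent neighbourhoods fits into \<open>V\<close>; thus the
    subtraction in \<open>m'\<close> is exact.\<close>
  have l2: "2 * k \<le> card V + l"
    using G.card_N_Un[OF aV(1,2)] G.card_N_adj[OF a] card_mono[OF G.finite_V, of "G.N a \<union> G.N b"]
      G.N_subset by fastforce
  have mu: "compl_mu v k l = int m'" using l2 v by (simp add: compl_mu_def m'_def)
  \<comment> \<open>The inequality \<open>l' + 1 < k'\<close> of the complement, written in the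
    parameters of the graph; \<open>mk'\<close> is the dual.\<close>
  have mk: "m < k" using pH(2) k1 unfolding k'_def l'_def by linarith
  have mk': "m' < k'" using pG(2) k1 l2 unfolding k'_def m'_def by linarith
  interpret GP: primitive_srg V E k l m
    by unfold_locales (use x0 pG mk in auto)
  interpret HP: primitive_srg V E' k' l' m'
    by unfold_locales (use x0 pH mk' in auto)
  \<comment> \<open>The threshold \<open>6401\<close> is \<open>80 * 80 + 1\<close>.\<close>
  have big: "80 \<le> j" if "card V \<le> j * j + 1" for j :: nat
  proof (rule ccontr)
    assume "\<not> 80 \<le> j"
    then have "j * j \<le> 79 * 79" by (intro mult_le_mono) auto
    then show False using that v assms(3) by simp
  qed
  have k80: "80 \<le> k" and k80': "80 \<le> k'" using big GP.card_V_le HP.card_V_le by auto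
  obtain p q where pq: "p \<in> V" "q \<in> V" "p \<noteq> q" "shatters V E {p, q}" using GP.shatters_pair by blast
  have "vc_dim G = 2 \<longleftrightarrow> (\<forall>S. shattered G S \<longrightarrow> card S \<noteq> 3)"
  proof (rule vc_dim_eq_2_iff)
    show "finite (pverts G)" using G.finite_V by (simp add: V_def)
    show "shattered G {p, q}" using pq by (simp add: shattered_iff V_def E_def)
    show "card {p, q} = 2" using pq by simp
  qed
  also have "\<dots> \<longleftrightarrow> (\<forall>x\<in>V. \<forall>y\<in>V. \<forall>z\<in>V. x \<noteq> y \<longrightarrow> x \<noteq> z \<longrightarrow> y \<noteq> z \<longrightarrow> \<not> shatters V E {x, y, z})"
    (is "_ \<longleftrightarrow> ?no3")
  proof
    assume no3: "\<forall>S. shattered G S \<longrightarrow> card S \<noteq> 3"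
    show ?no3
    proof (intro ballI impI notI)
      fix x y z assume "x \<in> V" "y \<in> V" "z \<in> V" "x \<noteq> y" "x \<noteq> z" "y \<noteq> z" "shatters V E {x, y, z}"
      then have "shattered G {x, y, z}" "card {x, y, z} = 3"
        by (simp_all add: shattered_iff V_def E_def)
      then show False using no3 by blast
    qed
  next
    assume no3: ?no3
    show "\<forall>S. shattered G S \<longrightarrow> card S \<noteq> 3"
    proof (intro allI impI notI)
      fix S assume S: "shattered G S" "card S = 3"
      then obtain x y z where xyz: "S = {x, y, z}" "x \<noteq> y" "x \<noteq> z" "y \<noteq> z"
        unfolding card_3_iff by blast
      then have "x \<in> V" "y \<in> V" "z \<in> V" "shatters V E {x, y, z}"
        using S(1) by (simp_all add: shattered_iff V_def E_def)
      then show False using no3 xyz by blast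
    qed
  qed
  also have "\<dots> \<longleftrightarrow> m' = 1"
  proof
    assume ?no3
    then interpret no_shattered_triple V E k l m by unfold_locales blast
    have "card V + l < 2 * k + 3" using few_common_nonneighbours k80 by simp
    then have "m' < 3" using l2 by (simp add: m'_def)
    moreover have "m' \<noteq> 2"
    proof
      assume m2: "m' = 2"
      have *: False if xyz: "x \<in> V" "y \<in> V" "z \<in> V" "x \<noteq> y" "x \<noteq> z" "y \<noteq> z"
        "shatters V (\<lambda>u s. \<not> E' u s \<and> u \<noteq> s) {x, y, z}" for x y z
      proof -
        \<comment> \<open>Being distinct and non-adjacent in the complement is adjacency in the
          graph.\<close>
        have "{s \<in> {x, y, z}. \<not> E' u s \<and> u \<noteq> s} = {s \<in> {x, y, z}. E u s}" if "u \<in> V" for u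
          using that xyz(1-3) G.E_irrefl by (auto simp: E'_def)
        then have "shatters V E {x, y, z}" using xyz(7) by (simp add: shatters_def)
        then show False using \<open>?no3\<close> xyz by blast
      qed
      have k10: "10 \<le> k'" using k80' by simp
      show False
      proof (cases "l' = 0")
        case True
        show False by (rule HP.closed_shatters_triple_no_triangle[OF m2 k10 True]) (rule *)
      next
        case False
        show False by (rule HP.closed_shatters_triple_triangle[OF m2 k10 False]) (rule *)
      qed
    qed
    ultimately show "m' = 1" using HP.m_pos by linarith
  next
    assume "m' = 1"
    then have "card V + l = 2 * k + 1" using l2 by (simp add: m'_def)
    then show ?no3 using G.no_shattered_triple_if_unique by blast
  qed
  also have "\<dots> \<longleftrightarrow> compl_mu v k l = 1" using mu by simp
  finally show ?thesis .
qed

end
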